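(* Let $\Gamma$ be a countably infinite discrete group and let $S$ be a finite subset of $\Gamma$. If $X$ is a free zero-dimensional Polish $\Gamma$-space, then $$\chi_c(G(X,S)) \,\leq\, \chi_c(G(\mathrm{Free}(2^\Gamma), S)).$$
   Context: A $\Gamma$-space is a topological space $X$ with a continuous left action $\Gamma \curvearrowright X$. It is free if the action is free, and zero-dimensional Polish if the underlying space is Polish and has a base of clopen sets. The product space $2^\Gamma$ is a $\Gamma$-space under the action $(\gamma \cdot x)(\delta) = x(\delta\gamma)$. Its free part $\mathrm{Free}(2^\Gamma)$ is the set of all points with trivial stabilizer, with the subspace topology and induced action. For a $\Gamma$-space $X$ and finite $S \subset \Gamma$, the Schreier graph $G(X,S)$ is the simple undirected graph with vertex set $X$ in which two distinct vertices $x,y$ are adjacent if and only if $y = \sigma \cdot x$ for some $\sigma \in S \cup S^{-1}$. For a graph $G$ whose vertex set is a zero-dimensional Polish space, the continuous chromatic number $\chi_c(G)$ is the least $k$ for which there is a continuous map $f \colon V(G) \to k = \{0,\ldots,k-1\}$ (discrete) with $f(x) \neq f(y)$ whenever $x$ and $y$ are adjacent. *)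

theory Defs
  imports "HOL-Analysis.Analysis" "HOL-Algebra.Group_Action" "HOL-Library.Extended_Nat"
begin

section \<open>Zero-dimensional Polish spaces\<close>

definition polish_top :: "'x topology \<Rightarrow> bool"
  where "polish_top X \<longleftrightarrow> completely_metrizable_space X \<and> separable_space X"

definition has_clopen_base :: "'x topology \<Rightarrow> bool"
  where "has_clopen_base X \<longleftrightarrow>
    (\<exists>\<B>. (\<forall>V\<in>\<B>. openin X V \<and> closedin X V) \<and>
         (\<forall>U x. openin X U \<and> x \<in> U \<longrightarrow> (\<exists>V\<in>\<B>. x \<in> V \<and> V \<subseteq> U)))"

definition zero_dim_polish :: "'x topology \<Rightarrow> bool"
  where "zero_dim_polish X \<longleftrightarrow> polish_top X \<and> has_clopen_base X"

section \<open>Spaces with a continuous action of a discrete group\<close>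

text \<open>
  The locale \<^locale>\<open>group_action\<close> makes each map \<open>\<phi> \<gamma>\<close> (for \<open>\<gamma>\<close> in the carrier of the group)
  a permutation of \<open>topspace X\<close> that is extensional, i.e. \<open>undefined\<close> outside \<open>topspace X\<close>.
  The group carries the discrete topology.
\<close>

definition gamma_space ::
    "('g, 'm) monoid_scheme \<Rightarrow> 'x topology \<Rightarrow> ('g \<Rightarrow> 'x \<Rightarrow> 'x) \<Rightarrow> bool"
  where "gamma_space \<Gamma> X \<phi> \<longleftrightarrow>
    group_action \<Gamma> (topspace X) \<phi> \<and>
    continuous_map (prod_topology (discrete_topology (carrier \<Gamma>)) X) X (\<lambda>(\<gamma>, x). \<phi> \<gamma> x)"

definition free_part ::
    "('g, 'm) monoid_scheme \<Rightarrow> 'x topology \<Rightarrow> ('g \<Rightarrow> 'x \<Rightarrow> 'x) \<Rightarrow> 'x set"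
  where "free_part \<Gamma> X \<phi> = {x \<in> topspace X. stabilizer \<Gamma> \<phi> x = {\<one>\<^bsub>\<Gamma>\<^esub>}}"

definition free_gamma_space ::
    "('g, 'm) monoid_scheme \<Rightarrow> 'x topology \<Rightarrow> ('g \<Rightarrow> 'x \<Rightarrow> 'x) \<Rightarrow> bool"
  where "free_gamma_space \<Gamma> X \<phi> \<longleftrightarrow>
    gamma_space \<Gamma> X \<phi> \<and> (\<forall>x\<in>topspace X. stabilizer \<Gamma> \<phi> x = {\<one>\<^bsub>\<Gamma>\<^esub>})"

section \<open>The Bernoulli shift and its free part\<close>

text \<open>
  Points of the product space \<open>2\<^sup>\<Gamma>\<close> are the functions from the carrier of \<open>\<Gamma>\<close> to \<open>{0, 1}\<close>,
  extended by \<open>undefined\<close> outside the carrier.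
\<close>

definition cantor_power :: "('g, 'm) monoid_scheme \<Rightarrow> ('g \<Rightarrow> nat) topology"
  where "cantor_power \<Gamma> = product_topology (\<lambda>_. discrete_topology {..<2}) (carrier \<Gamma>)"

definition shift :: "('g, 'm) monoid_scheme \<Rightarrow> 'g \<Rightarrow> ('g \<Rightarrow> nat) \<Rightarrow> ('g \<Rightarrow> nat)"
  where "shift \<Gamma> \<gamma> =
    (\<lambda>x\<in>topspace (cantor_power \<Gamma>). \<lambda>\<delta>\<in>carrier \<Gamma>. x (\<delta> \<otimes>\<^bsub>\<Gamma>\<^esub> \<gamma>))"

definition free_shift_space :: "('g, 'm) monoid_scheme \<Rightarrow> ('g \<Rightarrow> nat) topology"
  where "free_shift_space \<Gamma> =
    subtopology (cantor_power \<Gamma>) (free_part \<Gamma> (cantor_power \<Gamma>) (shift \<Gamma>))"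

definition free_shift :: "('g, 'm) monoid_scheme \<Rightarrow> 'g \<Rightarrow> ('g \<Rightarrow> nat) \<Rightarrow> ('g \<Rightarrow> nat)"
  where "free_shift \<Gamma> \<gamma> = restrict (shift \<Gamma> \<gamma>) (topspace (free_shift_space \<Gamma>))"

section \<open>Schreier graphs and continuous chromatic numbers\<close>

text \<open>
  A simple undirected graph whose vertex set is the underlying set of a topological space is
  given by that space together with the set of its edges, each edge being a two-element set.
\<close>

definition schreier_edges ::
    "('g, 'm) monoid_scheme \<Rightarrow> 'x topology \<Rightarrow> ('g \<Rightarrow> 'x \<Rightarrow> 'x) \<Rightarrow> 'g set \<Rightarrow> 'x set set"
  where "schreier_edges \<Gamma> X \<phi> S =
    {{x, y} | x y. x \<in> topspace X \<and> y \<in> topspace X \<and> x \<noteq> y \<and>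
       (\<exists>\<sigma> \<in> S \<union> (\<lambda>\<sigma>. inv\<^bsub>\<Gamma>\<^esub> \<sigma>) ` S. y = \<phi> \<sigma> x)}"

definition continuous_coloring :: "'x topology \<Rightarrow> 'x set set \<Rightarrow> nat \<Rightarrow> ('x \<Rightarrow> nat) \<Rightarrow> bool"
  where "continuous_coloring X E k f \<longleftrightarrow>
    continuous_map X (discrete_topology {..<k}) f \<and>
    (\<forall>x y. {x, y} \<in> E \<longrightarrow> f x \<noteq> f y)"

text \<open>
  The value is \<open>\<infinity>\<close> if there is no continuous proper coloring with finitely many colors;
  otherwise the infimum is attained.
\<close>

definition continuous_chromatic_number :: "'x topology \<Rightarrow> 'x set set \<Rightarrow> enat"
  where "continuous_chromatic_number X E = Inf {enat k | k. \<exists>f. continuous_coloring X E k f}"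

end

theory Submission
  imports Defs "HOL-Real_Asymp.Real_Asymp"
begin

text \<open>
  Write a subset of \<open>X\<close> as its indicator \<open>c\<close>. A clopen \<open>c\<close> gives a continuous equivariant map
  \<open>\<pi>\<close> from \<open>X\<close> to \<open>2\<^sup>\<Gamma>\<close>, \<open>\<pi> x a = c (a x)\<close>, and a map of this kind into the free part would pull
  back every coloring. In general there is none: on the 2-adic integers with
  translation by 1 every clopen set is periodic, so \<open>\<pi> x\<close> is never free. The proof therefore uses
  that only finitely many group elements matter at a time.

  There are clopen sets \<open>c\<^sub>0, c\<^sub>1, \<dots>\<close>, an enumeration \<open>\<gamma>\<^sub>0, \<gamma>\<^sub>1, \<dots>\<close> of the nontrivial group elements
  and finite sets \<open>D\<^sub>0, D\<^sub>1, \<dots>\<close> such that for \<open>n \<le> N\<close> every \<open>x\<close> has a \<open>\<delta>\<close> in \<open>D\<^sub>n\<close>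
  with \<open>c\<^sub>N (\<delta> x) \<noteq> c\<^sub>N (\<delta> \<gamma>\<^sub>n x)\<close> (\<open>color_sequence\<close>). Let \<open>K\<^sub>N\<close> be the set of all \<open>z\<close> in \<open>2\<^sup>\<Gamma>\<close>
  that satisfy the corresponding conditions for \<open>n \<le> N\<close> at all translates. These sets are closed,
  shift invariant and decreasing, the map \<open>\<pi>\<close> of \<open>c\<^sub>N\<close> takes values in \<open>K\<^sub>N\<close>, and the intersection
  of the \<open>K\<^sub>N\<close> consists of points with trivial stabilizer. A coloring of the free part, restricted
  to this compact intersection, extends to a locally constant function on \<open>2\<^sup>\<Gamma>\<close>. The set where the
  extension fails to be a proper coloring is closed and misses the intersection, so by
  compactness it misses some \<open>K\<^sub>N\<close>, and the extension can be pulled back along \<open>\<pi>\<close>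
  (\<open>coloring_transfer\<close>).

  The sequence is built by \<open>color_step\<close>, which deals with one \<open>\<gamma>\<close>. At each stage a clopen set \<open>W\<close>
  of points is still undecided; it is syndetic, meaning that every point is moved into \<open>W\<close> by
  some element of a fixed finite set. Choose a large finite window \<open>R\<close> and a maximal clopen set \<open>M\<close> of widely separated
  markers in \<open>W\<close>. The markers stay undecided. Around each marker \<open>m\<close>, the undecided points of \<open>R m\<close>
  receive a word of bits, and all other undecided points receive \<open>False\<close>. Since \<open>M\<close> is syndetic,
  it suffices to tell \<open>m\<close> from \<open>t m\<close> for each marker \<open>m\<close> and each \<open>t\<close> in a finite set of
  conjugates of \<open>\<gamma>\<close>.
  The number of conditions on one word grows polynomially with its length, whereas each
  condition excludes all but an exponentially small fraction of the words. Hence the words can be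
  chosen one after another, along a locally constant rank that gives different values to
  interacting markers.
\<close>

section \<open>Locally constant functions\<close>

text \<open>
  For maps into a discrete space this is continuity. No target set is fixed, so predicates,
  set-valued functions and ranks are handled alike.
\<close>

definition locally_const :: "'x topology \<Rightarrow> ('x \<Rightarrow> 'a) \<Rightarrow> bool"
  where "locally_const X f \<longleftrightarrow>
    (\<forall>x\<in>topspace X. \<exists>U. openin X U \<and> x \<in> U \<and> f constant_on U)"

lemma locally_constE:
  assumes "locally_const X f" "x \<in> topspace X"
  obtains U a where "openin X U" "x \<in> U" "\<forall>y\<in>U. f y = a"
  using assms unfolding locally_const_def constant_on_def by blast

lemma locally_constI:
  assumes "\<And>x. x \<in> topspace X \<Longrightarrow> \<exists>U a. openin X U \<and> x \<in> U \<and> (\<forall>y\<in>U. f y = a)"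
  shows "locally_const X f"
  using assms unfolding locally_const_def constant_on_def by blast

lemma locally_const_const: "locally_const X (\<lambda>x. a)"
  by (rule locally_constI) (auto intro: exI[of _ "topspace X"])

lemma locally_const_compose:
  assumes "locally_const X f" shows "locally_const X (\<lambda>x. h (f x))"
proof (rule locally_constI)
  fix x assume "x \<in> topspace X"
  with assms obtain U a where "openin X U" "x \<in> U" "\<forall>y\<in>U. f y = a"
    by (rule locally_constE)
  then show "\<exists>U b. openin X U \<and> x \<in> U \<and> (\<forall>y\<in>U. h (f y) = b)"
    by (intro exI[of _ U] exI[of _ "h a"]) simp
qed

lemma locally_const_compose2:
  assumes "locally_const X f" "locally_const X g"
  shows "locally_const X (\<lambda>x. h (f x) (g x))"
proof (rule locally_constI)
  fix x assume x: "x \<in> topspace X"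
  obtain U a where "openin X U" "x \<in> U" "\<forall>y\<in>U. f y = a"
    using assms(1) x by (rule locally_constE)
  moreover obtain V b where "openin X V" "x \<in> V" "\<forall>y\<in>V. g y = b"
    using assms(2) x by (rule locally_constE)
  ultimately show "\<exists>U c. openin X U \<and> x \<in> U \<and> (\<forall>y\<in>U. h (f y) (g y) = c)"
    by (intro exI[of _ "U \<inter> V"] exI[of _ "h a b"]) (simp add: openin_Int)
qed

lemma locally_const_conj:
  "locally_const X P \<Longrightarrow> locally_const X Q \<Longrightarrow> locally_const X (\<lambda>x. P x \<and> Q x)"
  by (rule locally_const_compose2[where h = "(\<and>)"])

text \<open>
  Since finitely many locally constant predicates can be recorded in one locally constant set, a
  function that inspects finitely many of them, even through Hilbert choice, is again locally
  constant.
\<close>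

lemma locally_const_Collect_finite:
  assumes "finite A" "\<And>a. a \<in> A \<Longrightarrow> locally_const X (P a)"
  shows "locally_const X (\<lambda>x. {a\<in>A. P a x})"
  using assms
proof (induction A rule: finite_induct)
  case empty
  then show ?case by (simp add: locally_const_const)
next
  case (insert b A)
  have "locally_const X (\<lambda>x. (\<lambda>q Q. if q then insert b Q else Q) (P b x) {a\<in>A. P a x})"
    by (rule locally_const_compose2) (use insert in auto)
  moreover have "{a \<in> insert b A. P a x} = (if P b x then insert b {a\<in>A. P a x} else {a\<in>A. P a x})"
    for x by auto
  ultimately show ?case by simp
qed

lemma locally_const_Ball:
  assumes "finite A" "\<And>a. a \<in> A \<Longrightarrow> locally_const X (P a)"
  shows "locally_const X (\<lambda>x. \<forall>a\<in>A. P a x)"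
proof -
  have "(\<forall>a\<in>A. P a x) = ({a\<in>A. P a x} = A)" for x by auto
  then show ?thesis
    using locally_const_compose[OF locally_const_Collect_finite[OF assms], where h = "\<lambda>Q. Q = A"]
    by simp
qed

lemma locally_const_Bex:
  assumes "finite A" "\<And>a. a \<in> A \<Longrightarrow> locally_const X (P a)"
  shows "locally_const X (\<lambda>x. \<exists>a\<in>A. P a x)"
proof -
  have "(\<exists>a\<in>A. P a x) = ({a\<in>A. P a x} \<noteq> {})" for x by auto
  then show ?thesis
    using locally_const_compose[OF locally_const_Collect_finite[OF assms], where h = "\<lambda>Q. Q \<noteq> {}"]
    by simp
qed

lemma locally_const_If:
  assumes "locally_const X P" "locally_const X f" "locally_const X g"
  shows "locally_const X (\<lambda>x. if P x then f x else g x)"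
proof -
  have "locally_const X (\<lambda>x. (\<lambda>p (a, b). if p then a else b) (P x) (f x, g x))"
    by (rule locally_const_compose2[OF assms(1)], rule locally_const_compose2[OF assms(2,3)])
  then show ?thesis by simp
qed

lemma locally_const_pullback:
  assumes "locally_const Y f" "continuous_map X Y g"
  shows "locally_const X (\<lambda>x. f (g x))"
proof (rule locally_constI)
  fix x assume x: "x \<in> topspace X"
  then have "g x \<in> topspace Y" using assms(2) continuous_map_image_subset_topspace by fastforce
  then obtain U a where U: "openin Y U" "g x \<in> U" "\<forall>y\<in>U. f y = a"
    by (rule locally_constE[OF assms(1)])
  then have "openin X {x \<in> topspace X. g x \<in> U}"
    using assms(2) openin_continuous_map_preimage by blast
  then show "\<exists>U a. openin X U \<and> x \<in> U \<and> (\<forall>y\<in>U. f (g y) = a)"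
    using U x by (intro exI[of _ "{x \<in> topspace X. g x \<in> U}"] exI[of _ a]) auto
qed

lemma locally_const_openin:
  assumes "locally_const X P" shows "openin X {x \<in> topspace X. P x}"
proof (subst openin_subopen, safe)
  fix x assume "x \<in> topspace X" "P x"
  obtain U a where U: "openin X U" "x \<in> U" "\<forall>y\<in>U. P y = a"
    using assms \<open>x \<in> topspace X\<close> by (rule locally_constE)
  moreover from U(2,3) \<open>P x\<close> have a by simp
  ultimately show "\<exists>T. openin X T \<and> x \<in> T \<and> T \<subseteq> {x \<in> topspace X. P x}"
    using openin_subset by (intro exI[of _ U]) auto
qed

lemma locally_const_closedin:
  assumes "locally_const X P" shows "closedin X {x \<in> topspace X. P x}"
proof -
  have "openin X {x \<in> topspace X. \<not> P x}"
    by (rule locally_const_openin, rule locally_const_compose[OF assms])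
  moreover have "topspace X - {x \<in> topspace X. P x} = {x \<in> topspace X. \<not> P x}" by auto
  ultimately show ?thesis unfolding closedin_def by auto
qed

lemma locally_const_clopen:
  assumes "openin X A" "closedin X A" shows "locally_const X (\<lambda>x. x \<in> A)"
proof (rule locally_constI)
  fix x assume "x \<in> topspace X"
  then show "\<exists>U a. openin X U \<and> x \<in> U \<and> (\<forall>y\<in>U. (y \<in> A) = a)"
    using assms
    by (intro exI[of _ "if x \<in> A then A else topspace X - A"] exI[of _ "x \<in> A"])
      (auto simp: closedin_def)
qed

lemma locally_const_imp_continuous_map:
  assumes "locally_const X f" "f \<in> topspace X \<rightarrow> S"
  shows "continuous_map X (discrete_topology S) f"
  unfolding continuous_map_def
  using assms(2) locally_const_openin[OF locally_const_compose[OF assms(1)]] by auto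

lemma continuous_map_imp_locally_const:
  assumes "continuous_map X (discrete_topology S) f"
  shows "locally_const X f"
proof (rule locally_constI)
  fix x assume x: "x \<in> topspace X"
  then have "f x \<in> S" using assms continuous_map_image_subset_topspace by fastforce
  then have "openin X {y \<in> topspace X. f y \<in> {f x}}"
    using assms by (intro openin_continuous_map_preimage) auto
  then show "\<exists>U a. openin X U \<and> x \<in> U \<and> (\<forall>y\<in>U. f y = a)" using x
    by (intro exI[of _ "{y \<in> topspace X. f y \<in> {f x}}"] exI[of _ "f x"]) auto
qed

text \<open>
  Greedy constructions: the value at \<open>x\<close> may depend on all values at points of smaller rank. On the
  points of rank \<open>i\<close> the recursion has been unfolded only \<open>i + 1\<close> times, so local constancy is
  preserved, even though the rank may be unbounded on \<open>X\<close>.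
\<close>

lemma locally_const_rank_recursion:
  fixes p :: "'x \<Rightarrow> nat" and \<Phi> :: "('x \<Rightarrow> 'b) \<Rightarrow> 'x \<Rightarrow> 'b"
  assumes p: "locally_const X p"
    and \<Phi>: "\<And>g. locally_const X g \<Longrightarrow> locally_const X (\<Phi> g)"
  obtains g where "locally_const X g"
    "\<forall>x. g x = \<Phi> (\<lambda>y. if p y < p x then g y else d) x"
proof -
  define G where "G = rec_nat (\<lambda>_. d) (\<lambda>i h x. if p x = i then \<Phi> h x else h x)"
  have G0: "G 0 = (\<lambda>_. d)" and GS: "G (Suc i) = (\<lambda>x. if p x = i then \<Phi> (G i) x else G i x)" for i
    unfolding G_def by simp_all
  define g where "g = (\<lambda>x. G (Suc (p x)) x)"
  have G_below: "G i = (\<lambda>y. if p y < i then g y else d)" for i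
  proof (induction i)
    case 0
    then show ?case by (simp add: G0)
  next
    case (Suc i)
    show ?case
    proof
      fix y
      consider "p y < i" | "p y = i" | "p y > i" by linarith
      then show "G (Suc i) y = (if p y < Suc i then g y else d)"
      proof cases
        case 1
        then have "G (Suc i) y = G i y" by (simp add: GS)
        then show ?thesis using 1 Suc by simp
      next
        case 2
        then show ?thesis by (simp add: g_def)
      next
        case 3
        then have "G (Suc i) y = G i y" by (simp add: GS)
        then show ?thesis using 3 Suc by simp
      qed
    qed
  qed
  have lcG: "locally_const X (G i)" for i
  proof (induction i)
    case 0
    then show ?case by (simp add: G0 locally_const_const)
  next
    case (Suc i)
    show ?case unfolding GS
      by (intro locally_const_If \<Phi> Suc locally_const_compose[OF p])
  qed
  have "locally_const X g"
  proof (rule locally_constI)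
    fix x assume x: "x \<in> topspace X"
    obtain U i where U: "openin X U" "x \<in> U" "\<forall>y\<in>U. p y = i"
      using p x by (rule locally_constE)
    obtain V a where V: "openin X V" "x \<in> V" "\<forall>y\<in>V. G (Suc i) y = a"
      using lcG[of "Suc i"] x by (rule locally_constE)
    show "\<exists>U a. openin X U \<and> x \<in> U \<and> (\<forall>y\<in>U. g y = a)"
      using U V by (intro exI[of _ "U \<inter> V"] exI[of _ a]) (auto simp: g_def)
  qed
  moreover have "g x = \<Phi> (\<lambda>y. if p y < p x then g y else d) x" for x
  proof -
    have "g x = \<Phi> (G (p x)) x" by (simp add: g_def GS)
    then show ?thesis by (simp only: G_below)
  qed
  ultimately show ?thesis using that by blast
qed

section \<open>Words avoiding many sparse conditions\<close>

text \<open>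
  A maximal subset \<open>C\<close> disjoint from its image satisfies \<open>B \<subseteq> C \<union> \<kappa> C \<union> \<kappa>\<^sup>-\<^sup>1 C\<close>, by maximality, so
  it contains at least a third of \<open>B\<close>.
\<close>

lemma large_displaced_subset:
  assumes "finite B" "inj_on \<kappa> B" "\<And>s. s \<in> B \<Longrightarrow> \<kappa> s \<noteq> s" "3 * k \<le> card B"
  obtains C where "C \<subseteq> B" "\<And>s. s \<in> C \<Longrightarrow> \<kappa> s \<notin> C" "k \<le> card C"
proof -
  define \<C> where "\<C> = {C. C \<subseteq> B \<and> (\<forall>s\<in>C. \<kappa> s \<notin> C)}"
  have "finite \<C>" "{} \<in> \<C>" using assms(1) by (auto simp: \<C>_def)
  then obtain C where C: "C \<in> \<C>" and max: "\<And>C'. C' \<in> \<C> \<Longrightarrow> C \<subseteq> C' \<Longrightarrow> C = C'"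
    using finite_has_maximal[of \<C>] by blast
  have CB: "C \<subseteq> B" and Ck: "\<And>s. s \<in> C \<Longrightarrow> \<kappa> s \<notin> C" using C by (auto simp: \<C>_def)
  have finC: "finite C" using CB assms(1) finite_subset by blast
  have "B \<subseteq> C \<union> \<kappa> ` C \<union> {s\<in>B. \<kappa> s \<in> C}"
  proof
    fix s assume s: "s \<in> B"
    show "s \<in> C \<union> \<kappa> ` C \<union> {s\<in>B. \<kappa> s \<in> C}"
    proof (rule ccontr)
      assume n: "s \<notin> C \<union> \<kappa> ` C \<union> {s\<in>B. \<kappa> s \<in> C}"
      have "insert s C \<in> \<C>"
        using n s CB Ck assms(3)[OF s] by (auto simp: \<C>_def)
      then show False using max[of "insert s C"] n by auto
    qed
  qed
  then have "card B \<le> card (C \<union> \<kappa> ` C \<union> {s\<in>B. \<kappa> s \<in> C})"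
    using finC assms(1) by (intro card_mono) auto
  also have "\<dots> \<le> card C + card (\<kappa> ` C) + card {s\<in>B. \<kappa> s \<in> C}"
    by (meson card_Un_le le_trans add_le_mono1)
  also have "card (\<kappa> ` C) \<le> card C" using finC card_image_le by blast
  also have "card {s\<in>B. \<kappa> s \<in> C} \<le> card C"
    by (rule card_inj_on_le[of \<kappa>]) (use assms(2) finC in \<open>auto simp: inj_on_def\<close>)
  finally have "k \<le> card C" using assms(4) by linarith
  then show ?thesis using that CB Ck by blast
qed

text \<open>
  A word is a subset \<open>u\<close> of \<open>B\<close>. Condition \<open>\<theta>\<close> compares the bit at \<open>s\<close> with a bit that is either
  constant or determined by the bit of \<open>u\<close> at another place \<open>\<kappa> \<theta> s\<close>. A word violates the
  condition if all comparisons agree, except possibly at the one exempt place that the summand 1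
  in the size of \<open>B\<close> accounts for. On a displaced set \<open>C\<close> of
  size at least \<open>k\<close> these agreements compute \<open>u \<inter> C\<close> from \<open>u - C\<close>, so at most a fraction \<open>2\<^sup>-\<^sup>k\<close>
  of the words violate \<open>\<theta>\<close>, and fewer than \<open>2\<^sup>k\<close> conditions cannot exclude all words.
\<close>

lemma word_avoiding_constraints:
  fixes K :: "'t \<Rightarrow> 'g \<Rightarrow> bool \<Rightarrow> bool"
  assumes fin: "finite B" "finite \<Theta>"
    and inj: "\<And>\<theta>. \<theta> \<in> \<Theta> \<Longrightarrow> inj_on (\<kappa> \<theta>) B"
    and nofix: "\<And>\<theta> s. \<theta> \<in> \<Theta> \<Longrightarrow> s \<in> B \<Longrightarrow> \<kappa> \<theta> s \<noteq> s"
    and exc: "\<And>\<theta> s s'. \<theta> \<in> \<Theta> \<Longrightarrow> s \<in> B \<Longrightarrow> s' \<in> B \<Longrightarrow> exempt \<theta> s \<Longrightarrow> exempt \<theta> s' \<Longrightarrow> s = s'"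
    and card: "3 * k + 1 \<le> card B" "card \<Theta> < 2 ^ k"
  obtains u where "u \<subseteq> B"
    "\<And>\<theta>. \<theta> \<in> \<Theta> \<Longrightarrow> \<exists>s\<in>B. \<not> exempt \<theta> s \<and> (s \<in> u) \<noteq> K \<theta> s (\<kappa> \<theta> s \<in> u)"
proof -
  define bad where
    "bad \<theta> = {u \<in> Pow B. \<forall>s\<in>B. exempt \<theta> s \<or> (s \<in> u) = K \<theta> s (\<kappa> \<theta> s \<in> u)}" for \<theta>
  have bad_card: "card (bad \<theta>) \<le> 2 ^ (card B - k)" if \<theta>: "\<theta> \<in> \<Theta>" for \<theta>
  proof -
    let ?B = "{s\<in>B. \<not> exempt \<theta> s}"
    have "card {s\<in>B. exempt \<theta> s} \<le> 1"
      using exc[OF \<theta>] fin(1) by (auto simp: card_le_Suc0_iff_eq)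
    moreover have "card B = card ?B + card {s\<in>B. exempt \<theta> s}"
    proof -
      have "B = ?B \<union> {s\<in>B. exempt \<theta> s}" by auto
      then show ?thesis using fin(1) card_Un_disjoint[of ?B "{s\<in>B. exempt \<theta> s}"] by fastforce
    qed
    ultimately have "3 * k \<le> card ?B" using card by linarith
    moreover have "inj_on (\<kappa> \<theta>) ?B" using inj[OF \<theta>] by (auto simp: inj_on_def)
    ultimately obtain C where C: "C \<subseteq> ?B" "\<And>s. s \<in> C \<Longrightarrow> \<kappa> \<theta> s \<notin> C" "k \<le> card C"
      using large_displaced_subset[of ?B "\<kappa> \<theta>" k] fin(1) nofix[OF \<theta>] by auto
    have "inj_on (\<lambda>u. u - C) (bad \<theta>)"
    proof (rule inj_onI)
      fix u v assume uv: "u \<in> bad \<theta>" "v \<in> bad \<theta>" "u - C = v - C"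
      have out: "s \<in> u \<longleftrightarrow> s \<in> v" if "s \<notin> C" for s using uv(3) that by blast
      have inC: "s \<in> u \<longleftrightarrow> s \<in> v" if s: "s \<in> C" for s
      proof -
        have "(s \<in> u) = K \<theta> s (\<kappa> \<theta> s \<in> u)" "(s \<in> v) = K \<theta> s (\<kappa> \<theta> s \<in> v)"
          using uv(1,2) s C(1) by (auto simp: bad_def)
        then show ?thesis using out[OF C(2)[OF s]] by simp
      qed
      show "u = v" using out inC by blast
    qed
    then have "card (bad \<theta>) \<le> card (Pow (B - C))"
      by (rule card_inj_on_le) (use fin(1) in \<open>auto simp: bad_def\<close>)
    also have "\<dots> = 2 ^ (card B - card C)"
      using fin(1) C(1) by (subst card_Pow) (auto intro!: card_Diff_subset finite_subset[of C B])
    also have "\<dots> \<le> 2 ^ (card B - k)" using C(3) by (intro power_increasing) auto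
    finally show ?thesis .
  qed
  have "card (\<Union>\<theta>\<in>\<Theta>. bad \<theta>) \<le> (\<Sum>\<theta>\<in>\<Theta>. card (bad \<theta>))"
    by (rule card_UN_le) (rule fin)
  also have "\<dots> \<le> card \<Theta> * 2 ^ (card B - k)"
    using sum_bounded_above[of \<Theta> "\<lambda>\<theta>. card (bad \<theta>)"] bad_card by simp
  also have "\<dots> < 2 ^ k * 2 ^ (card B - k)" using card(2) by simp
  also have "\<dots> = 2 ^ card B" using card(1) by (simp flip: power_add)
  also have "\<dots> = card (Pow B)" using fin(1) by (simp add: card_Pow)
  finally have "(\<Union>\<theta>\<in>\<Theta>. bad \<theta>) \<noteq> Pow B" by auto
  moreover have "(\<Union>\<theta>\<in>\<Theta>. bad \<theta>) \<subseteq> Pow B" by (auto simp: bad_def)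
  ultimately obtain u where "u \<in> Pow B" "u \<notin> (\<Union>\<theta>\<in>\<Theta>. bad \<theta>)" by blast
  then show ?thesis using that[of u] by (auto simp: bad_def)
qed

lemma exponential_beats_polynomial:
  fixes a :: nat
  shows "\<exists>k. a * (3 * k + 3) ^ 6 < 2 ^ k"
proof -
  have "eventually (\<lambda>k::nat. real a * (3 * real k + 3) ^ 6 < 2 ^ k) at_top"
    by real_asymp
  then obtain k :: nat where "real a * (3 * real k + 3) ^ 6 < 2 ^ k"
    using eventually_happens'[OF sequentially_bot] by blast
  moreover have "real a * (3 * real k + 3) ^ 6 = real (a * (3 * k + 3) ^ 6)"
    by simp
  ultimately have "a * (3 * k + 3) ^ 6 < 2 ^ k"
    by (metis of_nat_less_iff of_nat_numeral of_nat_power)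
  then show ?thesis ..
qed

section \<open>Free actions on zero-dimensional spaces and marker sets\<close>

lemma clopen_baseE:
  assumes "has_clopen_base X" "openin X U" "x \<in> U"
  obtains V where "openin X V" "closedin X V" "x \<in> V" "V \<subseteq> U"
  using assms unfolding has_clopen_base_def by blast

text \<open>
  Of a zero-dimensional Polish space this keeps what turns freeness, a pointwise condition, into
  countable clopen partitions: separation of points, the Lindelof property and a clopen base.
\<close>

locale free_zero_dim_action = group G for G (structure) +
  fixes X :: "'x topology" and \<phi> :: "'a \<Rightarrow> 'x \<Rightarrow> 'x"
  assumes infinite_carrier: "infinite (carrier G)"
    and act_in [simp]: "g \<in> carrier G \<Longrightarrow> x \<in> topspace X \<Longrightarrow> \<phi> g x \<in> topspace X"
    and act_one [simp]: "x \<in> topspace X \<Longrightarrow> \<phi> \<one> x = x"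
    and act_mult: "g \<in> carrier G \<Longrightarrow> h \<in> carrier G \<Longrightarrow> x \<in> topspace X \<Longrightarrow>
      \<phi> (g \<otimes> h) x = \<phi> g (\<phi> h x)"
    and act_free: "g \<in> carrier G \<Longrightarrow> x \<in> topspace X \<Longrightarrow> \<phi> g x = x \<Longrightarrow> g = \<one>"
    and act_cont: "g \<in> carrier G \<Longrightarrow> continuous_map X X (\<phi> g)"
    and Hausdorff: "Hausdorff_space X"
    and Lindelof: "Lindelof_space X"
    and clopen_base: "has_clopen_base X"
begin

lemma act_inv_act [simp]:
  "g \<in> carrier G \<Longrightarrow> x \<in> topspace X \<Longrightarrow> \<phi> (inv g) (\<phi> g x) = x"
  using act_mult[of "inv g" g x] by simp

lemma act_act_inv [simp]:
  "g \<in> carrier G \<Longrightarrow> x \<in> topspace X \<Longrightarrow> \<phi> g (\<phi> (inv g) x) = x"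
  using act_mult[of g "inv g" x] by simp

lemma act_eq_iff:
  assumes "g \<in> carrier G" "h \<in> carrier G" "x \<in> topspace X"
  shows "\<phi> g x = \<phi> h x \<longleftrightarrow> g = h"
proof
  assume "\<phi> g x = \<phi> h x"
  then have "\<phi> (inv h \<otimes> g) x = x" using assms by (simp add: act_mult)
  then have "inv h \<otimes> g = \<one>" using assms act_free by simp
  then have "h = g" using assms by (metis inv_closed inv_inv inv_equality)
  then show "g = h" by simp
qed simp

lemma locally_const_act:
  "locally_const X f \<Longrightarrow> g \<in> carrier G \<Longrightarrow> locally_const X (\<lambda>x. f (\<phi> g x))"
  by (rule locally_const_pullback[OF _ act_cont])

lemma clopen_displaced_nbhd:
  assumes "finite E" "E \<subseteq> carrier G" "\<one> \<notin> E" "x \<in> topspace X"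
  shows "\<exists>U. openin X U \<and> closedin X U \<and> x \<in> U \<and> (\<forall>e\<in>E. \<forall>y\<in>U. \<phi> e y \<notin> U)"
  using assms
proof (induction E rule: finite_induct)
  case empty
  then show ?case by (intro exI[of _ "topspace X"]) auto
next
  case (insert e E)
  then obtain U where U: "openin X U" "closedin X U" "x \<in> U" "\<forall>e\<in>E. \<forall>y\<in>U. \<phi> e y \<notin> U" by auto
  have e: "e \<in> carrier G" "e \<noteq> \<one>" using insert.prems by auto
  have "\<phi> e x \<noteq> x" using act_free e insert.prems by blast
  moreover have "x \<in> topspace X" "\<phi> e x \<in> topspace X" using e insert.prems by auto
  ultimately obtain A B where AB: "openin X A" "openin X B" "x \<in> A" "\<phi> e x \<in> B" "disjnt A B"
    using Hausdorff unfolding Hausdorff_space_def by metis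
  have "openin X (A \<inter> {y \<in> topspace X. \<phi> e y \<in> B})"
    by (intro openin_Int AB openin_continuous_map_preimage[OF act_cont[OF e(1)]])
  moreover have "x \<in> A \<inter> {y \<in> topspace X. \<phi> e y \<in> B}" using AB insert.prems by auto
  ultimately obtain V where V: "openin X V" "closedin X V" "x \<in> V"
    "V \<subseteq> A \<inter> {y \<in> topspace X. \<phi> e y \<in> B}"
    by (rule clopen_baseE[OF clopen_base])
  have "\<phi> e y \<notin> V" if "y \<in> V" for y
    using that V(4) AB(5) by (auto simp: disjnt_iff)
  then show ?case using U V by (intro exI[of _ "U \<inter> V"]) auto
qed

text \<open>
  By freeness every point has a clopen neighborhood that is disjoint from its images under the
  finitely many nontrivial elements of \<open>E\<close>. Countably many such neighborhoods cover \<open>X\<close>, and the rank of a point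
  is the index of the first one that contains it.
\<close>

lemma separating_rank:
  assumes "finite E" "E \<subseteq> carrier G"
  obtains p :: "'x \<Rightarrow> nat" where "locally_const X p"
    "\<forall>e\<in>E. \<forall>x\<in>topspace X. e \<noteq> \<one> \<longrightarrow> p (\<phi> e x) \<noteq> p x"
proof -
  define \<U> where "\<U> = {U. openin X U \<and> closedin X U \<and> (\<forall>e\<in>E - {\<one>}. \<forall>y\<in>U. \<phi> e y \<notin> U)}"
  have "\<Union>\<U> = topspace X"
  proof
    show "\<Union>\<U> \<subseteq> topspace X" using openin_subset by (auto simp: \<U>_def)
    show "topspace X \<subseteq> \<Union>\<U>"
      using clopen_displaced_nbhd[of "E - {\<one>}"] assms by (fastforce simp: \<U>_def)
  qed
  moreover have "\<And>U. U \<in> \<U> \<Longrightarrow> openin X U" by (simp add: \<U>_def)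
  ultimately obtain \<V> where \<V>: "countable \<V>" "\<V> \<subseteq> \<U>" "\<Union>\<V> = topspace X"
    using Lindelof unfolding Lindelof_space_def by metis
  show ?thesis
  proof (cases "\<V> = {}")
    case True
    then have "topspace X = {}" using \<V> by auto
    then show ?thesis using that[of "\<lambda>_. 0"] by (simp add: locally_const_def)
  next
    case False
    define U where "U = from_nat_into \<V>"
    have UV: "U i \<in> \<U>" for i using \<V>(2) False by (auto simp: U_def from_nat_into subset_iff)
    have cover: "\<exists>i. x \<in> U i" if "x \<in> topspace X" for x
      using that \<V> False by (metis U_def UnionE from_nat_into_surj)
    define p where "p = (\<lambda>x. LEAST i. x \<in> U i)"
    have pU: "x \<in> U (p x)" if "x \<in> topspace X" for x
      unfolding p_def using cover[OF that] by (rule LeastI_ex)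
    have "locally_const X p"
    proof (rule locally_constI)
      fix x assume x: "x \<in> topspace X"
      let ?V = "U (p x) \<inter> topspace X - (\<Union>i<p x. U i)"
      have op: "openin X ?V"
      proof (rule openin_diff)
        show "openin X (U (p x) \<inter> topspace X)" using UV[of "p x"] by (auto simp: \<U>_def)
        show "closedin X (\<Union>i<p x. U i)"
          using UV by (intro closedin_Union) (auto simp: \<U>_def)
      qed
      have xV: "x \<in> ?V" using pU[OF x] x not_less_Least unfolding p_def by fastforce
      have pV: "p y = p x" if "y \<in> ?V" for y
      proof -
        have "y \<in> U (p x)" "\<And>i. i < p x \<Longrightarrow> y \<notin> U i" using that by auto
        then show ?thesis unfolding p_def[THEN fun_cong, of y]
          by (intro Least_equality) (auto simp: not_less[symmetric])
      qed
      show "\<exists>V a. openin X V \<and> x \<in> V \<and> (\<forall>y\<in>V. p y = a)"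
        by (intro exI[of _ ?V] exI[of _ "p x"] conjI ballI op xV pV)
    qed
    moreover have "p (\<phi> e x) \<noteq> p x" if "e \<in> E" "e \<noteq> \<one>" "x \<in> topspace X" for e x
    proof
      assume eq: "p (\<phi> e x) = p x"
      have "\<phi> e x \<in> U (p x)" using pU[of "\<phi> e x"] that assms(2) eq by auto
      then show False using UV[of "p x"] pU[OF that(3)] that by (auto simp: \<U>_def)
    qed
    ultimately show ?thesis by (intro that) blast+
  qed
qed

text \<open>
  The greedy choice along a separating rank: a point of \<open>W\<close> is taken unless some \<open>E\<close>-translate of
  smaller rank has been taken.
\<close>

lemma maximal_separated_set:
  assumes E: "finite E" "E \<subseteq> carrier G" "\<forall>e\<in>E. inv e \<in> E"
    and W: "W \<subseteq> topspace X" "locally_const X (\<lambda>x. x \<in> W)"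
  obtains M where "M \<subseteq> W" "locally_const X (\<lambda>x. x \<in> M)"
    "\<forall>e\<in>E. \<forall>x\<in>M. \<phi> e x \<in> M \<longrightarrow> e = \<one>"
    "\<forall>x\<in>W. x \<in> M \<or> (\<exists>e\<in>E. \<phi> e x \<in> M)"
proof -
  obtain p :: "'x \<Rightarrow> nat" where p: "locally_const X p"
    "\<forall>e\<in>E. \<forall>x\<in>topspace X. e \<noteq> \<one> \<longrightarrow> p (\<phi> e x) \<noteq> p x"
    using E(1,2) by (rule separating_rank)
  define \<Phi> where "\<Phi> = (\<lambda>h x. x \<in> W \<and> (\<forall>e\<in>E. \<not> h (\<phi> e x)))"
  have lc\<Phi>: "locally_const X (\<Phi> h)" if h: "locally_const X h" for h
    unfolding \<Phi>_def
    by (intro locally_const_compose2[OF W(2), of _ "(\<and>)"] locally_const_Ball E(1)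
        locally_const_compose[OF locally_const_act[OF h]]) (use E(2) in auto)
  obtain \<mu> where \<mu>: "locally_const X \<mu>"
    "\<forall>x. \<mu> x = \<Phi> (\<lambda>y. if p y < p x then \<mu> y else False) x"
    using p(1) lc\<Phi> by (rule locally_const_rank_recursion[where d = False])
  have \<mu>': "\<mu> x \<longleftrightarrow> x \<in> W \<and> (\<forall>e\<in>E. p (\<phi> e x) < p x \<longrightarrow> \<not> \<mu> (\<phi> e x))" for x
    by (subst \<mu>(2)[rule_format]) (auto simp: \<Phi>_def)
  show ?thesis
  proof (rule that[of "{x. \<mu> x}"])
    show "{x. \<mu> x} \<subseteq> W" using \<mu>' by blast
    show "locally_const X (\<lambda>x. x \<in> {x. \<mu> x})" using \<mu>(1) by simp
  next
    show "\<forall>e\<in>E. \<forall>x\<in>{x. \<mu> x}. \<phi> e x \<in> {x. \<mu> x} \<longrightarrow> e = \<one>"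
    proof (intro ballI impI)
      fix e x assume e: "e \<in> E" and "x \<in> {x. \<mu> x}" "\<phi> e x \<in> {x. \<mu> x}"
      then have x: "\<mu> x" "\<mu> (\<phi> e x)" by auto
      then have xX: "x \<in> topspace X" using \<mu>' W(1) by blast
      have "\<not> p (\<phi> e x) < p x" using x e \<mu>' by blast
      moreover have "\<not> p x < p (\<phi> e x)"
        using x \<mu>'[of "\<phi> e x"] E(3)[rule_format, OF e] xX e E(2) by (metis act_inv_act subsetD)
      ultimately show "e = \<one>" using p(2) e xX by fastforce
    qed
    show "\<forall>x\<in>W. x \<in> {x. \<mu> x} \<or> (\<exists>e\<in>E. \<phi> e x \<in> {x. \<mu> x})" using \<mu>' by blast
  qed
qed

lemma disjoint_translates:
  assumes "finite F" "F \<subseteq> carrier G"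
  shows "\<exists>A. finite A \<and> A \<subseteq> carrier G \<and> card A = n \<and>
    (\<forall>a\<in>A. \<forall>b\<in>A. \<forall>f\<in>F. \<forall>g\<in>F. f \<otimes> a = g \<otimes> b \<longrightarrow> a = b)"
proof (induction n)
  case 0
  then show ?case by (intro exI[of _ "{}"]) auto
next
  case (Suc n)
  then obtain A where A: "finite A" "A \<subseteq> carrier G" "card A = n"
    "\<forall>a\<in>A. \<forall>b\<in>A. \<forall>f\<in>F. \<forall>g\<in>F. f \<otimes> a = g \<otimes> b \<longrightarrow> a = b" by blast
  let ?N = "A \<union> (\<lambda>(f, g, a). inv f \<otimes> (g \<otimes> a)) ` (F \<times> F \<times> A)"
  have "finite ?N" using A assms by auto
  then obtain c where c: "c \<in> carrier G" "c \<notin> ?N"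
    using infinite_carrier by (meson finite_subset subsetI)
  have new: "f \<otimes> c \<noteq> g \<otimes> a" if "f \<in> F" "g \<in> F" "a \<in> A" for f g a
  proof
    assume eq: "f \<otimes> c = g \<otimes> a"
    have fc: "f \<in> carrier G" using that assms by auto
    have "c = inv f \<otimes> (f \<otimes> c)" using fc c(1) by (simp flip: m_assoc)
    then have "c = inv f \<otimes> (g \<otimes> a)" using eq by simp
    then show False using c(2) that by (auto simp: image_iff)
  qed
  have "\<forall>a\<in>insert c A. \<forall>b\<in>insert c A. \<forall>f\<in>F. \<forall>g\<in>F. f \<otimes> a = g \<otimes> b \<longrightarrow> a = b"
    using A(4) new by (metis insert_iff)
  then show ?case using A c by (intro exI[of _ "insert c A"]) auto
qed

text \<open>
  The window is the union of \<open>n\<close> disjoint right translates \<open>F a\<close>; each of them carries a given point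
  into \<open>W\<close> at least once. What matters is that its size is linear in \<open>n\<close>.
\<close>

lemma large_window:
  assumes F: "finite F" "F \<subseteq> carrier G"
    and W: "\<forall>x\<in>topspace X. \<exists>f\<in>F. \<phi> f x \<in> W"
  obtains R where "finite R" "R \<subseteq> carrier G" "\<one> \<in> R" "card R \<le> n * card F + 1"
    "\<forall>x\<in>topspace X. n \<le> card {r\<in>R. \<phi> r x \<in> W}"
proof -
  obtain A where A: "finite A" "A \<subseteq> carrier G" "card A = n"
    "\<forall>a\<in>A. \<forall>b\<in>A. \<forall>f\<in>F. \<forall>g\<in>F. f \<otimes> a = g \<otimes> b \<longrightarrow> a = b"
    using disjoint_translates[OF F] by metis
  define R where "R = insert \<one> ((\<lambda>(f, a). f \<otimes> a) ` (F \<times> A))"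
  have "card R \<le> Suc (card ((\<lambda>(f, a). f \<otimes> a) ` (F \<times> A)))"
    unfolding R_def by (rule card_insert_le_m1) auto
  also have "card ((\<lambda>(f, a). f \<otimes> a) ` (F \<times> A)) \<le> card (F \<times> A)"
    using F A by (intro card_image_le) auto
  finally have cR: "card R \<le> n * card F + 1" using A(3) by (simp add: card_cartesian_product mult.commute)
  have finR: "finite R" using F A by (auto simp: R_def)
  have "n \<le> card {r\<in>R. \<phi> r x \<in> W}" if x: "x \<in> topspace X" for x
  proof -
    have "\<forall>a\<in>A. \<exists>f\<in>F. \<phi> f (\<phi> a x) \<in> W" using W x A(2) by (meson act_in subsetD)
    then obtain f where f: "\<And>a. a \<in> A \<Longrightarrow> f a \<in> F" "\<And>a. a \<in> A \<Longrightarrow> \<phi> (f a) (\<phi> a x) \<in> W"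
      by metis
    have "inj_on (\<lambda>a. f a \<otimes> a) A" using A(4) f(1) by (intro inj_onI) meson
    then have "n = card ((\<lambda>a. f a \<otimes> a) ` A)" using A(3) by (simp add: card_image)
    also have "\<dots> \<le> card {r\<in>R. \<phi> r x \<in> W}"
    proof (rule card_mono)
      show "finite {r\<in>R. \<phi> r x \<in> W}" using finR by simp
      show "(\<lambda>a. f a \<otimes> a) ` A \<subseteq> {r\<in>R. \<phi> r x \<in> W}"
      proof (rule image_subsetI)
        fix a assume a: "a \<in> A"
        then have "f a \<in> carrier G" "a \<in> carrier G" using f(1) F(2) A(2) by auto
        then show "f a \<otimes> a \<in> {r\<in>R. \<phi> r x \<in> W}"
          using f a x by (auto simp: R_def act_mult)
      qed
    qed
    finally show ?thesis .
  qed
  moreover have "R \<subseteq> carrier G" using F A by (auto simp: R_def)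
  moreover have "\<one> \<in> R" by (simp add: R_def)
  ultimately show ?thesis using that cR finR by blast
qed

text \<open>
  The color of \<open>h x\<close> when the block around \<open>x\<close> carries the word \<open>u\<close>, the block around any other
  marker \<open>m\<close> carries the word \<open>w m\<close>, and points outside \<open>W\<close> keep their color from \<open>c\<close>. Words are
  recorded in window coordinates: \<open>r\<close> belongs to the word at \<open>m\<close> if \<open>r m\<close> gets the color \<open>True\<close>.
\<close>

definition block_color ::
    "'a set \<Rightarrow> 'x set \<Rightarrow> 'x set \<Rightarrow> ('x \<Rightarrow> bool) \<Rightarrow> ('x \<Rightarrow> 'a set) \<Rightarrow> 'x \<Rightarrow> 'a set \<Rightarrow> 'a \<Rightarrow> bool"
  where "block_color R M W c w x u h \<longleftrightarrow>
    (if \<phi> h x \<in> W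
     then \<exists>r\<in>R. \<phi> (inv r \<otimes> h) x \<in> M \<and>
       r \<in> (if inv r \<otimes> h = \<one> then u else w (\<phi> (inv r \<otimes> h) x))
     else c (\<phi> h x))"

lemma inv_mult_eq_one_iff:
  "r \<in> carrier G \<Longrightarrow> h \<in> carrier G \<Longrightarrow> inv r \<otimes> h = \<one> \<longleftrightarrow> r = h"
  by (metis inv_closed inv_inv inv_equality l_inv)

lemma conj_neq_one:
  assumes "g \<in> carrier G" "t \<in> carrier G \<and> t \<noteq> \<one>"
  shows "g \<otimes> t \<otimes> inv g \<in> carrier G \<and> g \<otimes> t \<otimes> inv g \<noteq> \<one>"
proof -
  have "t = \<one>" if "g \<otimes> t \<otimes> inv g = \<one>"
  proof -
    have "t = inv g \<otimes> (g \<otimes> t \<otimes> inv g) \<otimes> g" using assms by (simp add: m_assoc inv_solve_left)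
    then show ?thesis using that assms by simp
  qed
  then show ?thesis using assms by auto
qed

lemma locally_const_block_color:
  assumes R: "finite R" "R \<subseteq> carrier G" and h: "h \<in> carrier G"
    and lc: "locally_const X (\<lambda>x. x \<in> M)" "locally_const X (\<lambda>x. x \<in> W)"
      "locally_const X c" "locally_const X w"
  shows "locally_const X (\<lambda>x. block_color R M W c w x u h)"
  unfolding block_color_def
proof (intro locally_const_If locally_const_Bex locally_const_conj R(1))
  show "locally_const X (\<lambda>x. \<phi> h x \<in> W)" using locally_const_act[OF lc(2) h] .
  show "locally_const X (\<lambda>x. c (\<phi> h x))" using locally_const_act[OF lc(3) h] .
  fix r assume "r \<in> R"
  then have g: "inv r \<otimes> h \<in> carrier G" using R h by auto
  show "locally_const X (\<lambda>x. \<phi> (inv r \<otimes> h) x \<in> M)" using locally_const_act[OF lc(1) g] .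
  show "locally_const X (\<lambda>x. r \<in> (if inv r \<otimes> h = \<one> then u else w (\<phi> (inv r \<otimes> h) x)))"
    by (rule locally_const_compose[OF locally_const_act[OF lc(4) g],
          of "\<lambda>v. r \<in> (if inv r \<otimes> h = \<one> then u else v)"])
qed

text \<open>
  Words are chosen in the order of the rank \<open>p\<close>; blocks of rank not below that of \<open>m\<close> count as empty when
  the word at \<open>m\<close> is chosen. Whatever the earlier words are, the bits at \<open>s m\<close> and \<open>s \<theta> m\<close> are
  related as in \<open>word_avoiding_constraints\<close>: the second bit depends on the word at \<open>m\<close> only
  through the place \<open>s \<theta> \<noteq> s\<close>.
\<close>

lemma word_assignment:
  fixes p :: "'x \<Rightarrow> nat"
  assumes R: "finite R" "R \<subseteq> carrier G"
    and \<Theta>: "finite \<Theta>" "\<Theta> \<subseteq> carrier G" "\<one> \<notin> \<Theta>"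
    and lc: "locally_const X (\<lambda>x. x \<in> M)" "locally_const X (\<lambda>x. x \<in> W)"
      "locally_const X c" "locally_const X p"
    and M: "M \<subseteq> topspace X"
    and sep: "\<forall>y\<in>topspace X. \<forall>s\<in>R. \<forall>t\<in>R. \<phi> s y \<in> M \<longrightarrow> \<phi> t y \<in> M \<longrightarrow> s = t"
    and large: "\<forall>m\<in>M. 3 * k + 1 \<le> card {r \<in> R - {\<one>}. \<phi> r m \<in> W}"
    and card: "card \<Theta> < 2 ^ k"
  obtains w where "locally_const X w"
    "\<forall>m\<in>M. \<forall>\<theta>\<in>\<Theta>.
      \<exists>s\<in>R - {\<one>}. \<phi> s m \<in> W \<and> \<phi> (s \<otimes> \<theta>) m \<notin> M \<and>
        (s \<in> w m) \<noteq>
          block_color R M W c (\<lambda>y. if p y < p m then w y else {}) m (w m) (s \<otimes> \<theta>)"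
proof -
  define P where "P = (\<lambda>w u x. \<forall>\<theta>\<in>\<Theta>. \<exists>s\<in>R - {\<one>}. \<phi> s x \<in> W \<and> \<phi> (s \<otimes> \<theta>) x \<notin> M \<and>
      (s \<in> u) \<noteq> block_color R M W c w x u (s \<otimes> \<theta>))"
  define \<Phi> where "\<Phi> = (\<lambda>w x. SOME u. u \<in> {u \<in> Pow R. P w u x})"
  have lc\<Phi>: "locally_const X (\<Phi> w)" if w: "locally_const X w" for w
    unfolding \<Phi>_def
  proof (rule locally_const_compose[where h = "\<lambda>U. SOME u. u \<in> U"],
      rule locally_const_Collect_finite)
    show "finite (Pow R)" using R by simp
    fix u assume u: "u \<in> Pow R"
    show "locally_const X (P w u)"
      unfolding P_def
    proof (intro locally_const_conj locally_const_Ball locally_const_Bex \<Theta>(1))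
      show "finite (R - {\<one>})" using R by simp
      fix \<theta> s assume \<theta>: "\<theta> \<in> \<Theta>" and s: "s \<in> R - {\<one>}"
      have cl: "s \<in> carrier G" "s \<otimes> \<theta> \<in> carrier G" using \<theta> s R \<Theta> by auto
      show "locally_const X (\<lambda>x. \<phi> s x \<in> W)" by (rule locally_const_act[OF lc(2) cl(1)])
      show "locally_const X (\<lambda>x. \<phi> (s \<otimes> \<theta>) x \<notin> M)"
        by (rule locally_const_compose[OF locally_const_act[OF lc(1) cl(2)]])
      show "locally_const X (\<lambda>x. (s \<in> u) \<noteq> block_color R M W c w x u (s \<otimes> \<theta>))"
        by (rule locally_const_compose[OF locally_const_block_color[OF R(1,2) cl(2) lc(1-3) w]])
    qed
  qed
  have ex: "\<exists>u. u \<in> {u \<in> Pow R. P w u m}" if m: "m \<in> M" for w m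
  proof -
    let ?B = "{r \<in> R - {\<one>}. \<phi> r m \<in> W}"
    have mX: "m \<in> topspace X" using m M by auto
    define K where "K = (\<lambda>\<theta> s b. if \<phi> (s \<otimes> \<theta>) m \<in> W
      then b \<or> (\<exists>r\<in>R. inv r \<otimes> (s \<otimes> \<theta>) \<noteq> \<one> \<and> \<phi> (inv r \<otimes> (s \<otimes> \<theta>)) m \<in> M \<and>
        r \<in> w (\<phi> (inv r \<otimes> (s \<otimes> \<theta>)) m))
      else c (\<phi> (s \<otimes> \<theta>) m))"
    obtain u where u: "u \<subseteq> ?B"
      "\<And>\<theta>. \<theta> \<in> \<Theta> \<Longrightarrow> \<exists>s\<in>?B. \<phi> (s \<otimes> \<theta>) m \<notin> M \<and> (s \<in> u) \<noteq> K \<theta> s (s \<otimes> \<theta> \<in> u)"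
    proof (rule word_avoiding_constraints[of ?B \<Theta> "\<lambda>\<theta> s. s \<otimes> \<theta>" "\<lambda>\<theta> s. \<phi> (s \<otimes> \<theta>) m \<in> M" k K])
      show "finite ?B" using R by simp
      show "finite \<Theta>" by fact
      show "inj_on (\<lambda>s. s \<otimes> \<theta>) ?B" if "\<theta> \<in> \<Theta>" for \<theta>
      proof (rule inj_onI)
        fix s t assume st: "s \<in> ?B" "t \<in> ?B" "s \<otimes> \<theta> = t \<otimes> \<theta>"
        then have "s \<in> carrier G" "t \<in> carrier G" "\<theta> \<in> carrier G" using that R \<Theta> by auto
        then show "s = t" using st(3) by simp
      qed
      show "s \<otimes> \<theta> \<noteq> s" if "\<theta> \<in> \<Theta>" "s \<in> ?B" for \<theta> s
      proof
        assume eq: "s \<otimes> \<theta> = s"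
        have cl: "s \<in> carrier G" "\<theta> \<in> carrier G" using that R \<Theta> by auto
        then have "s \<otimes> \<theta> = s \<otimes> \<one>" using eq by simp
        then have "\<theta> = \<one>" using cl by (metis Units_eq Units_l_cancel one_closed)
        then show False using that \<Theta> by auto
      qed
      show "s = s'" if "\<theta> \<in> \<Theta>" "s \<in> ?B" "s' \<in> ?B" "\<phi> (s \<otimes> \<theta>) m \<in> M" "\<phi> (s' \<otimes> \<theta>) m \<in> M" for \<theta> s s'
      proof -
        have cl: "s \<in> carrier G" "s' \<in> carrier G" "\<theta> \<in> carrier G" using that R \<Theta> by auto
        show ?thesis
          by (rule sep[rule_format, of "\<phi> \<theta> m"]) (use that cl mX in \<open>auto simp flip: act_mult\<close>)
      qed
      show "3 * k + 1 \<le> card ?B" using large[rule_format, OF m] .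
      show "card \<Theta> < 2 ^ k" by fact
    qed blast
    have "block_color R M W c w m u (s \<otimes> \<theta>) = K \<theta> s (s \<otimes> \<theta> \<in> u)"
      if "\<theta> \<in> \<Theta>" "s \<in> ?B" for \<theta> s
    proof -
      let ?h = "s \<otimes> \<theta>"
      have h: "?h \<in> carrier G" using that R \<Theta> by auto
      have one: "inv r \<otimes> ?h = \<one> \<longleftrightarrow> r = ?h" if "r \<in> R" for r
        using inv_mult_eq_one_iff that R h by blast
      have uR: "u \<subseteq> R" using u(1) by auto
      have "(\<exists>r\<in>R. \<phi> (inv r \<otimes> ?h) m \<in> M \<and>
          r \<in> (if inv r \<otimes> ?h = \<one> then u else w (\<phi> (inv r \<otimes> ?h) m))) \<longleftrightarrow>
        ?h \<in> u \<or> (\<exists>r\<in>R. inv r \<otimes> ?h \<noteq> \<one> \<and> \<phi> (inv r \<otimes> ?h) m \<in> M \<and> r \<in> w (\<phi> (inv r \<otimes> ?h) m))"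
        (is "?L \<longleftrightarrow> ?Q")
      proof
        assume ?L
        then obtain r where r: "r \<in> R" "\<phi> (inv r \<otimes> ?h) m \<in> M"
          "r \<in> (if inv r \<otimes> ?h = \<one> then u else w (\<phi> (inv r \<otimes> ?h) m))" by blast
        show ?Q
        proof (cases "inv r \<otimes> ?h = \<one>")
          case True
          then show ?thesis using r one[OF r(1)] by auto
        next
          case False
          then show ?thesis using r by auto
        qed
      next
        assume ?Q
        then show ?L
        proof
          assume hu: "?h \<in> u"
          then have hR: "?h \<in> R" using uR by auto
          then have "inv ?h \<otimes> ?h = \<one>" using one by blast
          then show ?L using hu hR m mX by (intro bexI[of _ ?h]) simp_all
        next
          assume "\<exists>r\<in>R. inv r \<otimes> ?h \<noteq> \<one> \<and> \<phi> (inv r \<otimes> ?h) m \<in> M \<and> r \<in> w (\<phi> (inv r \<otimes> ?h) m)"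
          then show ?L by auto
        qed
      qed
      then show ?thesis unfolding block_color_def K_def by simp
    qed
    then have "P w u m" unfolding P_def using u by fastforce
    then show ?thesis using u(1) by (intro exI[of _ u]) auto
  qed
  obtain w where w: "locally_const X w"
    "\<forall>x. w x = \<Phi> (\<lambda>y. if p y < p x then w y else {}) x"
    using lc(4) lc\<Phi> by (rule locally_const_rank_recursion[where d = "{}"])
  have good: "P (\<lambda>y. if p y < p m then w y else {}) (w m) m" if "m \<in> M" for m
  proof -
    let ?U = "{u \<in> Pow R. P (\<lambda>y. if p y < p m then w y else {}) u m}"
    have eq: "w m = (SOME u. u \<in> ?U)"
      using w(2)[rule_format, of m] unfolding \<Phi>_def .
    have "w m \<in> ?U"
      by (subst eq) (rule someI_ex[OF ex[OF that]])
    then show ?thesis by blast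
  qed
  show ?thesis
  proof (rule that[of w])
    show "locally_const X w" by fact
    show "\<forall>m\<in>M. \<forall>\<theta>\<in>\<Theta>. \<exists>s\<in>R - {\<one>}. \<phi> s m \<in> W \<and> \<phi> (s \<otimes> \<theta>) m \<notin> M \<and>
        (s \<in> w m) \<noteq>
          block_color R M W c (\<lambda>y. if p y < p m then w y else {}) m (w m) (s \<otimes> \<theta>)"
      using good unfolding P_def by blast
  qed
qed

text \<open>
  One stage of the construction. The new undecided set \<open>W'\<close> is the marker set. The color
  difference found for \<open>\<gamma>\<close> is witnessed outside \<open>W'\<close>, which is why later stages cannot destroy it.
\<close>

lemma color_step:
  fixes c :: "'x \<Rightarrow> bool"
  assumes F: "finite F" "F \<subseteq> carrier G" "\<forall>x\<in>topspace X. \<exists>f\<in>F. \<phi> f x \<in> W"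
    and W: "W \<subseteq> topspace X" "locally_const X (\<lambda>x. x \<in> W)"
    and c: "locally_const X c"
    and \<gamma>: "\<gamma> \<in> carrier G" "\<gamma> \<noteq> \<one>"
  obtains W' F' c' D where
    "finite F'" "F' \<subseteq> carrier G" "\<forall>x\<in>topspace X. \<exists>f\<in>F'. \<phi> f x \<in> W'"
    "W' \<subseteq> W" "locally_const X (\<lambda>x. x \<in> W')"
    "locally_const X c'" "\<forall>x. x \<notin> W \<longrightarrow> c' x = c x"
    "finite D" "D \<subseteq> carrier G"
    "\<forall>x\<in>topspace X. \<exists>\<delta>\<in>D. \<phi> \<delta> x \<notin> W' \<and> \<phi> (\<delta> \<otimes> \<gamma>) x \<notin> W' \<and> c' (\<phi> \<delta> x) \<noteq> c' (\<phi> (\<delta> \<otimes> \<gamma>) x)"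
proof -
  obtain k where k: "(2 * card F * (card F + 1) ^ 6) * (3 * k + 3) ^ 6 < 2 ^ k"
    using exponential_beats_polynomial by blast
  \<comment> \<open>The marker itself lies in its window and stays undecided, hence \<open>3 * k + 2\<close> where words of
    length \<open>3 * k + 1\<close> are wanted.\<close>
  obtain R where R: "finite R" "R \<subseteq> carrier G" "\<one> \<in> R" "card R \<le> (3 * k + 2) * card F + 1"
    "\<forall>x\<in>topspace X. 3 * k + 2 \<le> card {r\<in>R. \<phi> r x \<in> W}"
    by (rule large_window[OF F, where n = "3 * k + 2"])
  have Rc: "r \<in> carrier G" if "r \<in> R" for r using that R(2) by auto
  \<comment> \<open>No two markers differ by an element of \<open>E\<close>, some element of \<open>H\<close> moves a given point to a
    marker, \<open>T\<close> consists of the conjugates \<open>t\<close> of \<open>\<gamma>\<close> for which markers \<open>m\<close> are to be told from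
    \<open>t m\<close>, and \<open>\<Theta>\<close> collects the conditions on the word at one marker, also those that come from
    other markers whose translate by some \<open>t\<close> lies nearby.\<close>
  define E where "E = (\<lambda>(a, b, c, d). inv a \<otimes> b \<otimes> (inv c \<otimes> d)) ` (R \<times> R \<times> R \<times> R)"
  define H where "H = (\<lambda>(e, f). e \<otimes> f) ` (E \<times> F)"
  define T where "T = (\<lambda>\<delta>. \<delta> \<otimes> \<gamma> \<otimes> inv \<delta>) ` H"
  define \<Theta> where "\<Theta> = (\<lambda>(a, b, t). (inv a \<otimes> b) \<otimes> t \<otimes> inv (inv a \<otimes> b)) `
    (R \<times> R \<times> (T \<union> (\<lambda>t. inv t) ` T))"
  have fin: "finite E" "finite H" "finite T" "finite \<Theta>"
    using R(1) F(1) by (auto simp: E_def H_def T_def \<Theta>_def)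
  have Ec: "E \<subseteq> carrier G" using R(2) by (auto simp: E_def)
  have Hc: "H \<subseteq> carrier G" using Ec F(2) by (auto simp: H_def)
  have Tc: "t \<in> carrier G \<and> t \<noteq> \<one>" if "t \<in> T" for t
    using that \<gamma> Hc conj_neq_one unfolding T_def by auto
  have \<Theta>c: "\<Theta> \<subseteq> carrier G" "\<one> \<notin> \<Theta>"
  proof -
    have "\<theta> \<in> carrier G \<and> \<theta> \<noteq> \<one>" if \<theta>: "\<theta> \<in> \<Theta>" for \<theta>
    proof -
      obtain a b t where *: "a \<in> R" "b \<in> R" "t \<in> T \<union> (\<lambda>t. inv t) ` T"
        "\<theta> = (inv a \<otimes> b) \<otimes> t \<otimes> inv (inv a \<otimes> b)" using \<theta> unfolding \<Theta>_def by auto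
      have "t \<in> carrier G \<and> t \<noteq> \<one>" using *(3) Tc by (auto simp: inv_eq_1_iff)
      then show ?thesis using *(1,2,4) Rc conj_neq_one by simp
    qed
    then show "\<Theta> \<subseteq> carrier G" "\<one> \<notin> \<Theta>" by blast+
  qed
  \<comment> \<open>\<open>\<Theta>\<close> has at most \<open>2 |F| |R|\<^sup>6\<close> elements, and \<open>|R| \<le> (|F| + 1) (3 k + 3)\<close>.\<close>
  have card\<Theta>: "card \<Theta> < 2 ^ k"
  proof -
    have "card E \<le> card R ^ 4"
    proof -
      have "card E \<le> card (R \<times> R \<times> R \<times> R)" unfolding E_def by (rule card_image_le) (simp add: R(1))
      then show ?thesis by (simp add: card_cartesian_product power4_eq_xxxx mult.assoc)
    qed
    moreover have "card H \<le> card E * card F"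
      unfolding H_def using card_image_le[of "E \<times> F" "\<lambda>(e, f). e \<otimes> f"] fin F(1)
      by (simp add: card_cartesian_product)
    moreover have "card T \<le> card H" unfolding T_def by (rule card_image_le) (rule fin)
    moreover have "card (T \<union> (\<lambda>t. inv t) ` T) \<le> 2 * card T"
      using card_Un_le[of T "(\<lambda>t. inv t) ` T"] card_image_le[OF fin(3), of "\<lambda>t. inv t"] by linarith
    ultimately have TT: "card (T \<union> (\<lambda>t. inv t) ` T) \<le> 2 * (card R ^ 4 * card F)"
      by (meson le_trans mult_le_mono mult_le_mono1 le_refl)
    have "card \<Theta> \<le> card (R \<times> R \<times> (T \<union> (\<lambda>t. inv t) ` T))"
      unfolding \<Theta>_def by (rule card_image_le) (simp add: R(1) fin)
    also have "\<dots> \<le> card R * (card R * (2 * (card R ^ 4 * card F)))"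
      unfolding card_cartesian_product using TT by (intro mult_le_mono le_refl)
    also have "\<dots> = 2 * card F * card R ^ 6" by (simp add: eval_nat_numeral algebra_simps)
    also have "\<dots> \<le> 2 * card F * ((card F + 1) * (3 * k + 3)) ^ 6"
    proof (intro mult_le_mono le_refl power_mono)
      show "card R \<le> (card F + 1) * (3 * k + 3)"
        using R(4) by (simp add: algebra_simps)
    qed simp
    also have "\<dots> = (2 * card F * (card F + 1) ^ 6) * (3 * k + 3) ^ 6"
      by (simp only: power_mult_distrib mult.assoc)
    finally show ?thesis using k by linarith
  qed
  have Einv: "inv e \<in> E" if e: "e \<in> E" for e
  proof -
    obtain a b c d where *: "a \<in> R" "b \<in> R" "c \<in> R" "d \<in> R" "e = inv a \<otimes> b \<otimes> (inv c \<otimes> d)"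
      using e unfolding E_def by auto
    have "inv e = inv d \<otimes> c \<otimes> (inv b \<otimes> a)" using * Rc by (simp add: inv_mult_group m_assoc)
    then show ?thesis using * unfolding E_def by (auto intro!: image_eqI[of _ _ "(d, c, b, a)"])
  qed
  have oneE: "\<one> \<in> E"
    unfolding E_def using R(3) by (auto intro!: image_eqI[of _ _ "(\<one>, \<one>, \<one>, \<one>)"])
  obtain M where M: "M \<subseteq> W" "locally_const X (\<lambda>x. x \<in> M)"
    "\<forall>e\<in>E. \<forall>x\<in>M. \<phi> e x \<in> M \<longrightarrow> e = \<one>"
    "\<forall>x\<in>W. x \<in> M \<or> (\<exists>e\<in>E. \<phi> e x \<in> M)"
    by (rule maximal_separated_set[OF fin(1) Ec _ W]) (use Einv in blast)
  have MX: "m \<in> topspace X" if "m \<in> M" for m using that M(1) W(1) by auto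
  \<comment> \<open>The separation in the form used below: two markers that are connected by a path
    \<open>R\<^sup>-\<^sup>1 R R\<^sup>-\<^sup>1 R\<close> coincide.\<close>
  have sepM: "m' = m" if "m \<in> M" "m' \<in> M" "a \<in> R" "b \<in> R" "c \<in> R" "d \<in> R"
    "\<phi> a m' = \<phi> b (\<phi> (inv c) (\<phi> d m))" for m m' a b c d
  proof -
    have "\<phi> (inv a \<otimes> b \<otimes> (inv c \<otimes> d)) m = \<phi> (inv a) (\<phi> a m')"
      using that MX Rc by (simp add: act_mult)
    also have "\<dots> = m'" by (rule act_inv_act[OF Rc[OF that(3)] MX[OF that(2)]])
    finally have *: "\<phi> (inv a \<otimes> b \<otimes> (inv c \<otimes> d)) m = m'" .
    have "inv a \<otimes> b \<otimes> (inv c \<otimes> d) \<in> E"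
      unfolding E_def using that by (auto intro!: image_eqI[of _ _ "(a, b, c, d)"])
    then have "inv a \<otimes> b \<otimes> (inv c \<otimes> d) = \<one>" using M(3) that(1,2) * by metis
    then show ?thesis using * MX[OF that(1)] by simp
  qed
  have sep: "s = t" if "y \<in> topspace X" "s \<in> R" "t \<in> R" "\<phi> s y \<in> M" "\<phi> t y \<in> M" for s t y
  proof -
    have "\<phi> t y = \<phi> s y"
      using sepM[of "\<phi> s y" "\<phi> t y" \<one> t s \<one>] that Rc R(3) by simp
    then show ?thesis using that Rc act_eq_iff by metis
  qed
  have nonmarker: "\<phi> s m \<notin> M" if "m \<in> M" "s \<in> R - {\<one>}" for s m
    using sep[of m s \<one>] that R(3) MX by auto
  have large: "3 * k + 1 \<le> card {r \<in> R - {\<one>}. \<phi> r m \<in> W}" if "m \<in> M" for m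
  proof -
    have eq: "{r \<in> R - {\<one>}. \<phi> r m \<in> W} = {r\<in>R. \<phi> r m \<in> W} - {\<one>}" by auto
    have "card {r\<in>R. \<phi> r m \<in> W} - 1 \<le> card ({r\<in>R. \<phi> r m \<in> W} - {\<one>})"
      using diff_card_le_card_Diff[of "{\<one>}" "{r\<in>R. \<phi> r m \<in> W}"] by simp
    then show ?thesis unfolding eq using R(5)[rule_format, OF MX[OF that]] by linarith
  qed
  \<comment> \<open>Ranks must differ for markers \<open>m\<close> and \<open>m'\<close> for which the windows at \<open>t m\<close> and at \<open>m'\<close>
    overlap.\<close>
  define E2 where "E2 = (\<lambda>(a, b, t). inv a \<otimes> b \<otimes> t) ` (R \<times> R \<times> T)"
  have "finite E2" "E2 \<subseteq> carrier G" using R fin Tc Rc by (auto simp: E2_def)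
  then obtain p :: "'x \<Rightarrow> nat" where p: "locally_const X p"
    "\<forall>e\<in>E2. \<forall>x\<in>topspace X. e \<noteq> \<one> \<longrightarrow> p (\<phi> e x) \<noteq> p x"
    by (rule separating_rank)
  define col where "col = (\<lambda>w m. block_color R M W c (\<lambda>y. if p y < p m then w y else {}) m (w m))"
  obtain w where w: "locally_const X w"
    "\<forall>m\<in>M. \<forall>\<theta>\<in>\<Theta>. \<exists>s\<in>R - {\<one>}. \<phi> s m \<in> W \<and> \<phi> (s \<otimes> \<theta>) m \<notin> M \<and> (s \<in> w m) \<noteq> col w m (s \<otimes> \<theta>)"
    unfolding col_def
  proof (rule word_assignment[OF R(1,2) fin(4) \<Theta>c M(2) W(2) c p(1) _ _ _ card\<Theta>])
    show "M \<subseteq> topspace X" using MX by blast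
    show "\<forall>y\<in>topspace X. \<forall>s\<in>R. \<forall>t\<in>R. \<phi> s y \<in> M \<longrightarrow> \<phi> t y \<in> M \<longrightarrow> s = t"
      using sep by blast
    show "\<forall>m\<in>M. 3 * k + 1 \<le> card {r \<in> R - {\<one>}. \<phi> r m \<in> W}" using large by blast
  qed
  define c' where "c' = (\<lambda>x. if x \<in> W then \<exists>r\<in>R. \<phi> (inv r) x \<in> M \<and> r \<in> w (\<phi> (inv r) x) else c x)"
  have lc': "locally_const X c'"
    unfolding c'_def
    by (intro locally_const_If locally_const_Bex locally_const_conj R(1) W(2) c
        locally_const_act[OF M(2)] locally_const_compose[OF locally_const_act[OF w(1)]])
      (use Rc in auto)
  \<comment> \<open>Blocks of different markers are disjoint, so the final color on a block is its own word.\<close>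
  have own: "c' (\<phi> s m) \<longleftrightarrow> s \<in> w m" if m: "m \<in> M" and s: "s \<in> R" "\<phi> s m \<in> W" for m s
  proof -
    have uniq: "r = s \<and> \<phi> (inv r) (\<phi> s m) = m" if r: "r \<in> R" "\<phi> (inv r) (\<phi> s m) \<in> M" for r
    proof -
      have cl: "r \<in> carrier G" "s \<in> carrier G" "m \<in> topspace X" using r s m MX Rc by auto
      have eq: "\<phi> r (\<phi> (inv r) (\<phi> s m)) = \<phi> s m" using cl by simp
      also have "\<dots> = \<phi> s (\<phi> (inv \<one>) (\<phi> \<one> m))" using cl by simp
      finally have ret: "\<phi> (inv r) (\<phi> s m) = m" using sepM[of m _ r s \<one> \<one>] m r s R(3) by blast
      then have "\<phi> r m = \<phi> s m" using eq by simp
      then show ?thesis using act_eq_iff[of r s m] cl ret by simp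
    qed
    have ret: "\<phi> (inv s) (\<phi> s m) = m" using s m MX Rc by simp
    have "c' (\<phi> s m) \<longleftrightarrow> (\<exists>r\<in>R. \<phi> (inv r) (\<phi> s m) \<in> M \<and> r \<in> w (\<phi> (inv r) (\<phi> s m)))"
      using s(2) by (simp add: c'_def)
    also have "\<dots> \<longleftrightarrow> s \<in> w m"
    proof
      assume "\<exists>r\<in>R. \<phi> (inv r) (\<phi> s m) \<in> M \<and> r \<in> w (\<phi> (inv r) (\<phi> s m))"
      then obtain r where r: "r \<in> R" "\<phi> (inv r) (\<phi> s m) \<in> M" "r \<in> w (\<phi> (inv r) (\<phi> s m))"
        by blast
      then show "s \<in> w m" using uniq[OF r(1,2)] ret by simp
    next
      assume "s \<in> w m"
      then show "\<exists>r\<in>R. \<phi> (inv r) (\<phi> s m) \<in> M \<and> r \<in> w (\<phi> (inv r) (\<phi> s m))"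
        using s(1) m ret by (intro bexI[of _ s]) simp_all
    qed
    finally show ?thesis .
  qed
  \<comment> \<open>The color seen when the word at \<open>m\<close> was chosen is final at every point that lies in no block
    of another marker of at least the same rank.\<close>
  have agree: "col w m h = c' (\<phi> h m)"
    if m: "m \<in> M" and h: "h \<in> carrier G"
      and known: "\<And>r. r \<in> R \<Longrightarrow> \<phi> (inv r) (\<phi> h m) \<in> M \<Longrightarrow>
        \<phi> (inv r) (\<phi> h m) = m \<or> p (\<phi> (inv r) (\<phi> h m)) < p m" for m h
  proof -
    have "(\<phi> (inv r \<otimes> h) m \<in> M \<and>
        r \<in> (if inv r \<otimes> h = \<one> then w m
          else if p (\<phi> (inv r \<otimes> h) m) < p m then w (\<phi> (inv r \<otimes> h) m) else {})) \<longleftrightarrow>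
      (\<phi> (inv r) (\<phi> h m) \<in> M \<and> r \<in> w (\<phi> (inv r) (\<phi> h m)))" if r: "r \<in> R" for r
    proof -
      have g: "inv r \<otimes> h \<in> carrier G" using r h Rc by auto
      have eq: "\<phi> (inv r \<otimes> h) m = \<phi> (inv r) (\<phi> h m)" using r h m Rc MX by (simp add: act_mult)
      show ?thesis
      proof (cases "inv r \<otimes> h = \<one>")
        case True
        then have "\<phi> (inv r) (\<phi> h m) = m" using eq MX[OF m] by simp
        then show ?thesis using True eq by simp
      next
        case False
        then have "\<phi> (inv r) (\<phi> h m) \<noteq> m" using act_free[OF g MX[OF m]] eq by auto
        then show ?thesis using False known[OF r] eq by auto
      qed
    qed
    then show ?thesis unfolding col_def block_color_def c'_def by simp
  qed
  \<comment> \<open>For the condition that compares the marker \<open>m\<close> with the point \<open>t m\<close>, the responsible word is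
    the one at \<open>m\<close>, unless the window at \<open>t m\<close> meets the window of a marker \<open>m'\<close> chosen later.\<close>
  have core: "\<exists>a\<in>R. \<exists>b\<in>R. \<exists>d\<in>R. let q = a \<otimes> inv b \<otimes> d in
      \<phi> q m \<notin> M \<and> \<phi> q (\<phi> t m) \<notin> M \<and> c' (\<phi> q m) \<noteq> c' (\<phi> q (\<phi> t m))"
    if m: "m \<in> M" and t: "t \<in> T" for m t
  proof -
    have mX: "m \<in> topspace X" and tc: "t \<in> carrier G" using MX m Tc t by auto
    let ?y = "\<phi> t m"
    have yX: "?y \<in> topspace X" using mX tc by simp
    show ?thesis
    proof (cases "\<exists>m'\<in>M. \<exists>r\<in>R. \<exists>s\<in>R. \<phi> r ?y = \<phi> s m' \<and> p m < p m'")
      case False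
      have "t \<in> \<Theta>"
        unfolding \<Theta>_def using t tc R(3) by (auto intro!: image_eqI[of _ _ "(\<one>, \<one>, t)"])
      then obtain s where s: "s \<in> R - {\<one>}" "\<phi> s m \<in> W" "\<phi> (s \<otimes> t) m \<notin> M"
        "(s \<in> w m) \<noteq> col w m (s \<otimes> t)" using w(2) m by blast
      have sc: "s \<in> carrier G" using s(1) Rc by auto
      have st: "\<phi> (s \<otimes> t) m = \<phi> s ?y" using sc tc mX by (simp add: act_mult)
      have "col w m (s \<otimes> t) = c' (\<phi> (s \<otimes> t) m)"
      proof (rule agree[OF m])
        show "s \<otimes> t \<in> carrier G" using sc tc by simp
        fix r assume r: "r \<in> R" and rM: "\<phi> (inv r) (\<phi> (s \<otimes> t) m) \<in> M"
        let ?m = "\<phi> (inv r) (\<phi> (s \<otimes> t) m)"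
        have rc: "r \<in> carrier G" using r Rc by auto
        have "\<phi> s ?y = \<phi> r ?m" using rc sc st yX by simp
        then have le: "p ?m \<le> p m" using False rM s(1) r by (metis DiffD1 not_le)
        have meq: "?m = \<phi> (inv r \<otimes> s \<otimes> t) m" using rc sc tc mX st by (simp add: act_mult)
        have in2: "inv r \<otimes> s \<otimes> t \<in> E2"
          unfolding E2_def using r s(1) t by (auto intro!: image_eqI[of _ _ "(r, s, t)"])
        show "?m = m \<or> p ?m < p m"
        proof (cases "inv r \<otimes> s \<otimes> t = \<one>")
          case True
          then show ?thesis using meq mX by simp
        next
          case False
          then have "p ?m \<noteq> p m" using p(2)[rule_format, OF in2 mX] meq by simp
          then show ?thesis using le by linarith
        qed
      qed
      then have "c' (\<phi> s m) \<noteq> c' (\<phi> s ?y)" using s own[OF m, of s] st by auto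
      moreover have "\<phi> s m \<notin> M" using nonmarker[OF m s(1)] .
      moreover have "\<phi> s ?y \<notin> M" using s(3) st by simp
      ultimately show ?thesis
        using s(1) sc R(3) by (intro bexI[of _ s] bexI[of _ \<one>]) (auto simp: Let_def)
    next
      case True
      then obtain m' r s0 where m': "m' \<in> M" "r \<in> R" "s0 \<in> R" "\<phi> r ?y = \<phi> s0 m'" "p m < p m'"
        by blast
      \<comment> \<open>Here \<open>m' = \<beta> t m\<close> is responsible. Relative to \<open>m'\<close> the comparison of \<open>t m\<close> with \<open>m\<close> is the
        condition with the conjugate \<open>\<theta>\<close> of \<open>t\<^sup>-\<^sup>1\<close>, and shifting the window by \<open>\<beta>\<close> makes it contain
        the whole block of \<open>m'\<close>. The shifted window at \<open>m\<close> still meets no block but that of \<open>m\<close>.\<close>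
      define \<beta> where "\<beta> = inv s0 \<otimes> r"
      have cl: "r \<in> carrier G" "s0 \<in> carrier G" "\<beta> \<in> carrier G" using m' Rc by (auto simp: \<beta>_def)
      have m'X: "m' \<in> topspace X" using MX m' by auto
      have \<beta>y: "\<phi> \<beta> ?y = m'" unfolding \<beta>_def using cl yX m' m'X by (simp add: act_mult)
      define \<theta> where "\<theta> = \<beta> \<otimes> inv t \<otimes> inv \<beta>"
      have "\<theta> \<in> \<Theta>"
        unfolding \<Theta>_def \<theta>_def \<beta>_def using t m'
        by (auto intro!: image_eqI[of _ _ "(s0, r, inv t)"])
      then obtain s where s: "s \<in> R - {\<one>}" "\<phi> s m' \<in> W" "\<phi> (s \<otimes> \<theta>) m' \<notin> M"
        "(s \<in> w m') \<noteq> col w m' (s \<otimes> \<theta>)" using w(2) m'(1) by blast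
      have sc: "s \<in> carrier G" using s(1) Rc by auto
      have \<theta>c: "\<theta> \<in> carrier G" using cl tc by (simp add: \<theta>_def)
      have "\<phi> (inv \<beta>) m' = ?y" using \<beta>y cl(3) yX by (metis act_inv_act)
      then have \<theta>m: "\<phi> \<theta> m' = \<phi> \<beta> m"
        unfolding \<theta>_def using cl tc mX m'X by (simp add: act_mult)
      define q where "q = s \<otimes> inv s0 \<otimes> r"
      have q: "q = s \<otimes> \<beta>" unfolding q_def \<beta>_def using sc cl by (simp add: m_assoc)
      have qy: "\<phi> q ?y = \<phi> s m'" unfolding q using sc cl yX \<beta>y by (simp add: act_mult)
      have qm: "\<phi> q m = \<phi> (s \<otimes> \<theta>) m'"
        unfolding q using sc cl mX \<theta>m \<theta>c m'X by (simp add: act_mult)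
      have "col w m' (s \<otimes> \<theta>) = c' (\<phi> (s \<otimes> \<theta>) m')"
      proof (rule agree[OF m'(1)])
        show "s \<otimes> \<theta> \<in> carrier G" using sc \<theta>c by simp
        fix r' assume r': "r' \<in> R" and rM: "\<phi> (inv r') (\<phi> (s \<otimes> \<theta>) m') \<in> M"
        have "\<phi> r' (\<phi> (inv r') (\<phi> (s \<otimes> \<theta>) m')) = \<phi> q m"
          using r' Rc qm sc \<theta>c m'X by simp
        also have "\<dots> = \<phi> s (\<phi> (inv s0) (\<phi> r m))"
          unfolding q_def using sc cl mX by (simp add: act_mult)
        finally have "\<phi> (inv r') (\<phi> (s \<otimes> \<theta>) m') = m"
          using sepM[OF m rM r' _ m'(3,2)] s(1) by blast
        then show "\<phi> (inv r') (\<phi> (s \<otimes> \<theta>) m') = m' \<or> p (\<phi> (inv r') (\<phi> (s \<otimes> \<theta>) m')) < p m'"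
          using m'(5) by simp
      qed
      then have "c' (\<phi> q m) \<noteq> c' (\<phi> q ?y)" using s own[OF m'(1), of s] qm qy by auto
      moreover have "\<phi> q ?y \<notin> M" using nonmarker[OF m'(1) s(1)] qy by simp
      moreover have "\<phi> q m \<notin> M" using s(3) qm by simp
      ultimately show ?thesis
        using s(1) m'(2,3) unfolding q_def
        by (intro bexI[of _ s] bexI[of _ s0] bexI[of _ r]) (auto simp: Let_def)
    qed
  qed
  have syndetic: "\<exists>h\<in>H. \<phi> h x \<in> M" if x: "x \<in> topspace X" for x
  proof -
    obtain f where f: "f \<in> F" "\<phi> f x \<in> W" using F(3)[rule_format, OF x] by blast
    have fc: "f \<in> carrier G" using f F(2) by auto
    obtain e where e: "e \<in> E" "\<phi> e (\<phi> f x) \<in> M"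
      using M(4)[rule_format, OF f(2)] oneE fc x by (metis act_in act_one)
    have "e \<otimes> f \<in> H" unfolding H_def using e f by auto
    moreover have "\<phi> (e \<otimes> f) x \<in> M" using e fc Ec x by (auto simp: act_mult)
    ultimately show ?thesis by blast
  qed
  define D where "D = (\<lambda>(a, b, d, h). a \<otimes> inv b \<otimes> d \<otimes> h) ` (R \<times> R \<times> R \<times> H)"
  show ?thesis
  proof (rule that[of H M c' D])
    show "finite H" "H \<subseteq> carrier G" "M \<subseteq> W" "locally_const X (\<lambda>x. x \<in> M)" "locally_const X c'"
      by fact+
    show "\<forall>x\<in>topspace X. \<exists>f\<in>H. \<phi> f x \<in> M" using syndetic by blast
    show "\<forall>x. x \<notin> W \<longrightarrow> c' x = c x" by (simp add: c'_def)
    show "finite D" using R(1) fin(2) by (simp add: D_def)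
    show "D \<subseteq> carrier G" using Rc Hc by (auto simp: D_def)
    show "\<forall>x\<in>topspace X. \<exists>\<delta>\<in>D. \<phi> \<delta> x \<notin> M \<and> \<phi> (\<delta> \<otimes> \<gamma>) x \<notin> M \<and> c' (\<phi> \<delta> x) \<noteq> c' (\<phi> (\<delta> \<otimes> \<gamma>) x)"
    proof
      fix x assume x: "x \<in> topspace X"
      obtain h where h: "h \<in> H" "\<phi> h x \<in> M" using syndetic[OF x] by blast
      have hc: "h \<in> carrier G" using h Hc by auto
      define t where "t = h \<otimes> \<gamma> \<otimes> inv h"
      have tT: "t \<in> T" using h unfolding T_def t_def by auto
      have tm: "\<phi> t (\<phi> h x) = \<phi> (h \<otimes> \<gamma>) x" unfolding t_def using hc \<gamma> x by (simp add: act_mult)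
      obtain a b d where abd: "a \<in> R" "b \<in> R" "d \<in> R"
        and *: "let q = a \<otimes> inv b \<otimes> d in \<phi> q (\<phi> h x) \<notin> M \<and> \<phi> q (\<phi> t (\<phi> h x)) \<notin> M \<and>
          c' (\<phi> q (\<phi> h x)) \<noteq> c' (\<phi> q (\<phi> t (\<phi> h x)))"
        using core[OF h(2) tT] by blast
      define q where "q = a \<otimes> inv b \<otimes> d"
      have qc: "q \<in> carrier G" using abd Rc by (simp add: q_def)
      have "\<phi> q (\<phi> h x) = \<phi> (q \<otimes> h) x" using qc hc x by (simp add: act_mult)
      moreover have "\<phi> q (\<phi> t (\<phi> h x)) = \<phi> (q \<otimes> h \<otimes> \<gamma>) x"
        unfolding tm using qc hc x \<gamma> by (simp add: act_mult)
      moreover have "q \<otimes> h \<in> D"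
        unfolding D_def q_def using abd h by (auto intro!: image_eqI[of _ _ "(a, b, d, h)"])
      ultimately show "\<exists>\<delta>\<in>D. \<phi> \<delta> x \<notin> M \<and> \<phi> (\<delta> \<otimes> \<gamma>) x \<notin> M \<and> c' (\<phi> \<delta> x) \<noteq> c' (\<phi> (\<delta> \<otimes> \<gamma>) x)"
        using * unfolding q_def[symmetric] Let_def by auto
    qed
  qed
qed

end

section \<open>Extending a coloring from a compact set\<close>

text \<open>
  A compact set is covered by finitely many of the clopen subsets of the given neighborhood.
\<close>

lemma compactin_clopen_nbhd:
  assumes Z: "has_clopen_base Z" and K: "compactin Z K" "K \<subseteq> U" and U: "openin Z U"
  obtains A where "openin Z A" "closedin Z A" "K \<subseteq> A" "A \<subseteq> U"
proof -
  define \<V> where "\<V> = {V. openin Z V \<and> closedin Z V \<and> V \<subseteq> U}"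
  have "K \<subseteq> \<Union>\<V>"
  proof
    fix x assume "x \<in> K"
    then have "x \<in> U" using K by auto
    then obtain V where "openin Z V" "closedin Z V" "x \<in> V" "V \<subseteq> U"
      by (rule clopen_baseE[OF Z U])
    then show "x \<in> \<Union>\<V>" by (auto simp: \<V>_def)
  qed
  then obtain \<F> where \<F>: "finite \<F>" "\<F> \<subseteq> \<V>" "K \<subseteq> \<Union>\<F>"
    using compactinD[OF K(1), of \<V>] by (auto simp: \<V>_def)
  show ?thesis
  proof (rule that[of "\<Union>\<F>"])
    show "openin Z (\<Union>\<F>)" using \<F>(2) by (intro openin_Union) (auto simp: \<V>_def)
    show "closedin Z (\<Union>\<F>)" using \<F>(1,2) by (intro closedin_Union) (auto simp: \<V>_def)
    show "\<Union>\<F> \<subseteq> U" using \<F>(2) by (auto simp: \<V>_def)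
  qed (rule \<F>)
qed

text \<open>
  The color classes on \<open>K\<close> are compact and can be enlarged to clopen sets \<open>A i\<close> that on \<open>K\<close> meet no
  other class. The enlarged sets may overlap or miss points off \<open>K\<close>, where the extension takes
  some value determined by the indices \<open>i\<close> with \<open>z \<in> A i\<close>, possibly outside \<open>{..<k}\<close>.
\<close>

lemma locally_const_extension:
  fixes f :: "'x \<Rightarrow> nat"
  assumes Z: "compact_space Z" "has_clopen_base Z" and K: "closedin Z K" "K \<subseteq> Y"
    and f: "continuous_map (subtopology Z Y) (discrete_topology {..<k}) f"
  obtains f' where "locally_const Z f'" "\<forall>z\<in>K. f' z = f z"
proof -
  have KZ: "K \<subseteq> topspace Z" using K(1) closedin_subset by blast
  have fk: "f z < k" if "z \<in> K" for z
    using f that K(2) KZ unfolding continuous_map_def by (auto simp: Pi_iff)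
  have "\<exists>U. openin Z U \<and> {z \<in> topspace Z \<inter> Y. f z = i} = U \<inter> Y" if "i < k" for i
  proof -
    have "openin (subtopology Z Y) {z \<in> topspace (subtopology Z Y). f z \<in> {i}}"
      using that by (intro openin_continuous_map_preimage[OF f]) auto
    then have "openin (subtopology Z Y) {z \<in> topspace Z \<inter> Y. f z = i}" by simp
    then show ?thesis unfolding openin_subtopology by blast
  qed
  then obtain U where U: "\<And>i. i < k \<Longrightarrow> openin Z (U i)"
    "\<And>i. i < k \<Longrightarrow> {z \<in> topspace Z \<inter> Y. f z = i} = U i \<inter> Y" by metis
  have fU: "z \<in> U i \<longleftrightarrow> f z = i" if "z \<in> K" "i < k" for z i
    using U(2)[OF that(2)] that(1) K(2) KZ by blast
  have "\<exists>A. openin Z A \<and> closedin Z A \<and> {z\<in>K. f z = i} \<subseteq> A \<and> A \<subseteq> U i" if i: "i < k" for i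
  proof -
    have "{z\<in>K. f z = i} = K - (\<Union>j\<in>{..<k} - {i}. U j)" using fU fk i by auto
    moreover have "closedin Z (K - (\<Union>j\<in>{..<k} - {i}. U j))"
      using U(1) by (intro closedin_diff K openin_Union) auto
    ultimately have "compactin Z {z\<in>K. f z = i}" using Z(1) closedin_compact_space by metis
    moreover have "{z\<in>K. f z = i} \<subseteq> U i" using fU i by auto
    ultimately obtain A where "openin Z A" "closedin Z A" "{z\<in>K. f z = i} \<subseteq> A" "A \<subseteq> U i"
      using U(1)[OF i] by (rule compactin_clopen_nbhd[OF Z(2)])
    then show ?thesis by blast
  qed
  then obtain A where A: "\<And>i. i < k \<Longrightarrow> openin Z (A i)" "\<And>i. i < k \<Longrightarrow> closedin Z (A i)"
    "\<And>i. i < k \<Longrightarrow> {z\<in>K. f z = i} \<subseteq> A i" "\<And>i. i < k \<Longrightarrow> A i \<subseteq> U i" by metis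
  define f' where "f' = (\<lambda>z. Min {i \<in> {..<k}. z \<in> A i})"
  have "locally_const Z f'"
    unfolding f'_def
    by (rule locally_const_compose[where h = Min], rule locally_const_Collect_finite)
      (auto intro: locally_const_clopen A)
  moreover have "f' z = f z" if z: "z \<in> K" for z
  proof -
    have "z \<in> A i \<longleftrightarrow> i = f z" if "i < k" for i
      using A(3)[OF that] A(4)[OF that] fU[OF z that] z by blast
    then have "{i \<in> {..<k}. z \<in> A i} = {f z}" using fk[OF z] by auto
    then show ?thesis by (simp add: f'_def)
  qed
  ultimately show ?thesis using that by blast
qed

section \<open>The Bernoulli shift\<close>

lemma topspace_cantor_power: "topspace (cantor_power G) = (\<Pi>\<^sub>E a\<in>carrier G. {..<2})"
  by (simp add: cantor_power_def)

lemma compact_space_cantor_power: "compact_space (cantor_power G)"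
  by (simp add: cantor_power_def compact_space_product_topology compact_space_discrete_topology)

lemma has_clopen_base_cantor_power: "has_clopen_base (cantor_power G)"
proof -
  let ?B = "{V. openin (cantor_power G) V \<and> closedin (cantor_power G) V}"
  have "\<exists>V\<in>?B. x \<in> V \<and> V \<subseteq> U" if "openin (cantor_power G) U" "x \<in> U" for U x
  proof -
    have "\<exists>V. finite {i \<in> carrier G. V i \<noteq> topspace (discrete_topology {..<2::nat})} \<and>
        (\<forall>i\<in>carrier G. openin (discrete_topology {..<2::nat}) (V i)) \<and>
        x \<in> Pi\<^sub>E (carrier G) V \<and> Pi\<^sub>E (carrier G) V \<subseteq> U"
      using that unfolding cantor_power_def openin_product_topology_alt by blast
    then obtain V where V: "finite {i \<in> carrier G. V i \<noteq> topspace (discrete_topology {..<2::nat})}"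
      "\<forall>i\<in>carrier G. openin (discrete_topology {..<2::nat}) (V i)"
      "x \<in> Pi\<^sub>E (carrier G) V" "Pi\<^sub>E (carrier G) V \<subseteq> U" by blast
    have "openin (cantor_power G) (Pi\<^sub>E (carrier G) V)"
      unfolding cantor_power_def openin_PiE_gen using V(1,2) by blast
    moreover have "closedin (cantor_power G) (Pi\<^sub>E (carrier G) V)"
      unfolding cantor_power_def closedin_product_topology using V(2) by auto
    ultimately show ?thesis using V(3,4) by blast
  qed
  then show ?thesis unfolding has_clopen_base_def by (intro exI[of _ ?B]) auto
qed

lemma locally_const_coordinate:
  assumes "a \<in> carrier G" shows "locally_const (cantor_power G) (\<lambda>z. z a)"
proof -
  have "continuous_map (cantor_power G) (discrete_topology {..<2::nat}) (\<lambda>z. z a)"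
    unfolding cantor_power_def
    using continuous_map_product_projection[OF assms, of "\<lambda>_. discrete_topology {..<2::nat}"] .
  then show ?thesis by (rule continuous_map_imp_locally_const)
qed

lemma continuous_map_into_cantor_power:
  assumes "\<And>x. x \<in> topspace X \<Longrightarrow> g x \<in> topspace (cantor_power G)"
    and "\<And>a. a \<in> carrier G \<Longrightarrow> locally_const X (\<lambda>x. g x a)"
  shows "continuous_map X (cantor_power G) g"
  unfolding cantor_power_def
proof (subst continuous_map_componentwise, intro conjI ballI)
  show "g ` topspace X \<subseteq> extensional (carrier G)"
    using assms(1) unfolding topspace_cantor_power by (auto simp: PiE_iff)
  show "continuous_map X (discrete_topology {..<2}) (\<lambda>x. g x a)" if "a \<in> carrier G" for a
    using assms that unfolding topspace_cantor_power
    by (intro locally_const_imp_continuous_map) (auto simp: PiE_iff)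
qed

context group
begin

lemma shift_apply:
  assumes "z \<in> topspace (cantor_power G)" "a \<in> carrier G"
  shows "shift G s z a = z (a \<otimes> s)"
  using assms by (simp add: shift_def)

lemma shift_in_cantor_power:
  assumes "z \<in> topspace (cantor_power G)" "s \<in> carrier G"
  shows "shift G s z \<in> topspace (cantor_power G)"
  using assms by (auto simp: shift_def topspace_cantor_power PiE_iff)

lemma continuous_map_shift:
  assumes "s \<in> carrier G"
  shows "continuous_map (cantor_power G) (cantor_power G) (shift G s)"
proof (rule continuous_map_into_cantor_power)
  show "shift G s z \<in> topspace (cantor_power G)" if "z \<in> topspace (cantor_power G)" for z
    using shift_in_cantor_power[OF that assms] .
  fix a assume a: "a \<in> carrier G"
  then have "continuous_map (cantor_power G) (discrete_topology {..<2}) (\<lambda>z. z (a \<otimes> s))"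
    using assms by (intro locally_const_imp_continuous_map locally_const_coordinate)
      (auto simp: topspace_cantor_power PiE_iff)
  then have "continuous_map (cantor_power G) (discrete_topology {..<2}) (\<lambda>z. shift G s z a)"
    by (rule continuous_map_eq) (simp add: shift_apply a)
  then show "locally_const (cantor_power G) (\<lambda>z. shift G s z a)"
    by (rule continuous_map_imp_locally_const)
qed

lemma shift_one: "z \<in> topspace (cantor_power G) \<Longrightarrow> shift G \<one> z = z"
  by (rule ext) (auto simp: shift_def topspace_cantor_power PiE_iff extensional_def)

end

section \<open>Transferring colorings\<close>

context free_zero_dim_action
begin

text \<open>
  All undecided sets are nested, so the witnesses found at stage \<open>n\<close> keep their colors forever. No
  limit coloring is formed: the undecided sets may have points in common.
\<close>

lemma color_sequence:
  assumes \<gamma>: "\<forall>n::nat. \<gamma> n \<in> carrier G \<and> \<gamma> n \<noteq> \<one>"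
  obtains c :: "nat \<Rightarrow> 'x \<Rightarrow> bool" and D where "\<forall>n. locally_const X (c n)"
    "\<forall>n. finite (D n) \<and> D n \<subseteq> carrier G"
    "\<forall>n N. n \<le> N \<longrightarrow> (\<forall>x\<in>topspace X. \<exists>\<delta>\<in>D n. c N (\<phi> \<delta> x) \<noteq> c N (\<phi> (\<delta> \<otimes> \<gamma> n) x))"
proof -
  define P where "P = (\<lambda>(n::nat) (W, c::'x \<Rightarrow> bool). W \<subseteq> topspace X \<and> locally_const X (\<lambda>x. x \<in> W) \<and>
    (\<exists>F. finite F \<and> F \<subseteq> carrier G \<and> (\<forall>x\<in>topspace X. \<exists>f\<in>F. \<phi> f x \<in> W)) \<and> locally_const X c)"
  define separated where "separated = (\<lambda>n W c D. finite D \<and> D \<subseteq> carrier G \<and>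
    (\<forall>x\<in>topspace X. \<exists>\<delta>\<in>D. \<phi> \<delta> x \<notin> W \<and> \<phi> (\<delta> \<otimes> \<gamma> n) x \<notin> W \<and>
      (c (\<phi> \<delta> x) :: bool) \<noteq> c (\<phi> (\<delta> \<otimes> \<gamma> n) x)))"
  define Q where "Q = (\<lambda>n (W, c) (W', c'). W' \<subseteq> W \<and> (\<forall>x. x \<notin> W \<longrightarrow> c' x = c x) \<and>
    (\<exists>D. separated n W' c' D))"
  have "\<exists>s. \<forall>n. P n (s n) \<and> Q n (s n) (s (Suc n))"
  proof (rule dependent_nat_choice)
    have "P 0 (topspace X, \<lambda>_. False)"
      unfolding P_def prod.case
      by (intro conjI exI[of _ "{\<one>}"] locally_const_const locally_const_clopen) auto
    then show "\<exists>s. P 0 s" by blast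
  next
    fix s n assume s: "P n s"
    obtain W c where Wc: "s = (W, c)" by (cases s)
    obtain F where "finite F" "F \<subseteq> carrier G" "\<forall>x\<in>topspace X. \<exists>f\<in>F. \<phi> f x \<in> W"
      and W: "W \<subseteq> topspace X" "locally_const X (\<lambda>x. x \<in> W)" and "locally_const X c"
      using s unfolding P_def Wc by auto
    then obtain W' F' c' D where
      "finite F'" "F' \<subseteq> carrier G" "\<forall>x\<in>topspace X. \<exists>f\<in>F'. \<phi> f x \<in> W'"
      "W' \<subseteq> W" "locally_const X (\<lambda>x. x \<in> W')"
      "locally_const X c'" "\<forall>x. x \<notin> W \<longrightarrow> c' x = c x"
      "finite D" "D \<subseteq> carrier G"
      "\<forall>x\<in>topspace X. \<exists>\<delta>\<in>D. \<phi> \<delta> x \<notin> W' \<and> \<phi> (\<delta> \<otimes> \<gamma> n) x \<notin> W' \<and> c' (\<phi> \<delta> x) \<noteq> c' (\<phi> (\<delta> \<otimes> \<gamma> n) x)"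
      using \<gamma>[rule_format, THEN conjunct1] \<gamma>[rule_format, THEN conjunct2] by (rule color_step)
    then have "P (Suc n) (W', c')" "Q n (W, c) (W', c')"
      unfolding P_def Q_def separated_def prod.case using W(1) by blast+
    then show "\<exists>s'. P (Suc n) s' \<and> Q n s s'" unfolding Wc by blast
  qed
  then obtain s where s: "\<And>n. P n (s n)" "\<And>n. Q n (s n) (s (Suc n))" by blast
  define W where "W = (\<lambda>n. fst (s n))"
  define c where "c = (\<lambda>n. snd (s n))"
  have sn: "s n = (W n, c n)" for n by (simp add: W_def c_def)
  have step: "W (Suc n) \<subseteq> W n" "\<And>x. x \<notin> W n \<Longrightarrow> c (Suc n) x = c n x"
    "\<exists>D. separated n (W (Suc n)) (c (Suc n)) D" for n
    using s(2)[of n] unfolding Q_def sn by auto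
  obtain D where D: "\<And>n. separated n (W (Suc n)) (c (Suc n)) (D n)" using step(3) by metis
  have stable: "x \<notin> W m \<Longrightarrow> c (m + j) x = c m x \<and> x \<notin> W (m + j)" for m j x
  proof (induction j)
    case (Suc j)
    then show ?case using step(1)[of "m + j"] step(2)[of x "m + j"] by auto
  qed simp
  show ?thesis
  proof (rule that[of "\<lambda>n. c (Suc n)" D])
    show "\<forall>n. locally_const X (c (Suc n))" using s(1) unfolding P_def sn by auto
    show "\<forall>n. finite (D n) \<and> D n \<subseteq> carrier G" using D unfolding separated_def by blast
    show "\<forall>n N. n \<le> N \<longrightarrow> (\<forall>x\<in>topspace X. \<exists>\<delta>\<in>D n. c (Suc N) (\<phi> \<delta> x) \<noteq> c (Suc N) (\<phi> (\<delta> \<otimes> \<gamma> n) x))"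
    proof (intro allI impI ballI)
      fix n N :: nat and x assume "n \<le> N" and x: "x \<in> topspace X"
      then have N: "Suc N = Suc n + (N - n)" by simp
      obtain \<delta> where \<delta>: "\<delta> \<in> D n" "\<phi> \<delta> x \<notin> W (Suc n)" "\<phi> (\<delta> \<otimes> \<gamma> n) x \<notin> W (Suc n)"
        "c (Suc n) (\<phi> \<delta> x) \<noteq> c (Suc n) (\<phi> (\<delta> \<otimes> \<gamma> n) x)"
        using D[of n] x unfolding separated_def by blast
      have "c (Suc N) (\<phi> \<delta> x) = c (Suc n) (\<phi> \<delta> x)"
        "c (Suc N) (\<phi> (\<delta> \<otimes> \<gamma> n) x) = c (Suc n) (\<phi> (\<delta> \<otimes> \<gamma> n) x)"
        unfolding N using stable \<delta>(2,3) by blast+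
      then show "\<exists>\<delta>\<in>D n. c (Suc N) (\<phi> \<delta> x) \<noteq> c (Suc N) (\<phi> (\<delta> \<otimes> \<gamma> n) x)"
        using \<delta>(1,4) by (intro bexI[of _ \<delta>]) simp_all
    qed
  qed
qed

text \<open>
  Compactness reduces the infinitely many freeness conditions to the finitely many satisfied by
  one of the clopen sets \<open>c n\<close>.
\<close>

lemma coloring_transfer:
  assumes S: "finite S" "S \<subseteq> carrier G" and count: "countable (carrier G)"
    and f: "continuous_coloring (free_shift_space G)
      (schreier_edges G (free_shift_space G) (free_shift G) S) k f"
  shows "\<exists>h. continuous_coloring X (schreier_edges G X \<phi> S) k h"
proof -
  let ?Z = "cantor_power G"
  define \<gamma> where "\<gamma> = from_nat_into (carrier G - {\<one>})"
  have ne: "carrier G - {\<one>} \<noteq> {}" using infinite_carrier by (metis finite.simps infinite_remove)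
  have \<gamma>: "\<gamma> n \<in> carrier G" "\<gamma> n \<noteq> \<one>" for n
    using from_nat_into[OF ne, of n] by (auto simp: \<gamma>_def)
  have \<gamma>_nontrivial: "\<forall>n. \<gamma> n \<in> carrier G \<and> \<gamma> n \<noteq> \<one>" using \<gamma> by simp
  have \<gamma>_surj: "\<exists>n. \<gamma> n = g" if "g \<in> carrier G" "g \<noteq> \<one>" for g
    unfolding \<gamma>_def using that count by (intro from_nat_into_surj) auto
  obtain c :: "nat \<Rightarrow> 'x \<Rightarrow> bool" and D where c: "\<forall>n. locally_const X (c n)"
    and D: "\<forall>n. finite (D n) \<and> D n \<subseteq> carrier G"
    and sep: "\<forall>n N. n \<le> N \<longrightarrow> (\<forall>x\<in>topspace X. \<exists>\<delta>\<in>D n. c N (\<phi> \<delta> x) \<noteq> c N (\<phi> (\<delta> \<otimes> \<gamma> n) x))"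
    using \<gamma>_nontrivial by (rule color_sequence)
  have Dc: "\<delta> \<in> carrier G" if "\<delta> \<in> D n" for \<delta> n using D that by blast
  define K where "K = (\<lambda>n. {z \<in> topspace ?Z. \<forall>i\<le>n. \<forall>a\<in>carrier G.
    \<exists>\<delta>\<in>D i. z (\<delta> \<otimes> a) \<noteq> z (\<delta> \<otimes> \<gamma> i \<otimes> a)})"
  have K_closed: "closedin ?Z (K n)" for n
  proof -
    have eq: "K n = (\<Inter>(i, a)\<in>{..n} \<times> carrier G.
        {z \<in> topspace ?Z. \<exists>\<delta>\<in>D i. z (\<delta> \<otimes> a) \<noteq> z (\<delta> \<otimes> \<gamma> i \<otimes> a)})"
      unfolding K_def using one_closed by blast
    have basic: "closedin ?Z {z \<in> topspace ?Z. \<exists>\<delta>\<in>D i. z (\<delta> \<otimes> a) \<noteq> z (\<delta> \<otimes> \<gamma> i \<otimes> a)}"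
      if "a \<in> carrier G" for i a
    proof (rule locally_const_closedin, rule locally_const_Bex)
      show "finite (D i)" using D by blast
      fix \<delta> assume "\<delta> \<in> D i"
      then show "locally_const ?Z (\<lambda>z. z (\<delta> \<otimes> a) \<noteq> z (\<delta> \<otimes> \<gamma> i \<otimes> a))"
        using that \<gamma> Dc
        by (intro locally_const_compose2[where h = "(\<noteq>)"] locally_const_coordinate) auto
    qed
    show ?thesis
      unfolding eq
    proof (rule closedin_INT)
      show "{..n} \<times> carrier G \<noteq> {}" using one_closed by blast
      show "closedin ?Z (case p of (i, a) \<Rightarrow>
          {z \<in> topspace ?Z. \<exists>\<delta>\<in>D i. z (\<delta> \<otimes> a) \<noteq> z (\<delta> \<otimes> \<gamma> i \<otimes> a)})"
        if "p \<in> {..n} \<times> carrier G" for p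
        using that basic by (cases p) simp
    qed
  qed
  have K_dec: "K n \<subseteq> K m" if "m \<le> n" for m n using that unfolding K_def by fastforce
  have K_shift: "shift G s z \<in> K n" if z: "z \<in> K n" and s: "s \<in> carrier G" for s z n
  proof -
    have zZ: "z \<in> topspace ?Z" using z by (simp add: K_def)
    have "\<exists>\<delta>\<in>D i. shift G s z (\<delta> \<otimes> a) \<noteq> shift G s z (\<delta> \<otimes> \<gamma> i \<otimes> a)"
      if ia: "i \<le> n" "a \<in> carrier G" for i a
    proof -
      obtain \<delta> where \<delta>: "\<delta> \<in> D i" "z (\<delta> \<otimes> (a \<otimes> s)) \<noteq> z (\<delta> \<otimes> \<gamma> i \<otimes> (a \<otimes> s))"
        using z ia m_closed[OF ia(2) s] unfolding K_def by blast
      have "\<delta> \<in> carrier G" using Dc \<delta> by blast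
      then have "shift G s z (\<delta> \<otimes> a) \<noteq> shift G s z (\<delta> \<otimes> \<gamma> i \<otimes> a)"
        using \<delta>(2) zZ ia s \<gamma> by (simp add: shift_apply m_assoc)
      then show ?thesis using \<delta>(1) by blast
    qed
    then show ?thesis using shift_in_cantor_power[OF zZ s] by (simp add: K_def)
  qed
  define L where "L = (\<Inter>n. K n)"
  have LZ: "z \<in> topspace ?Z" if "z \<in> L" for z using that by (auto simp: L_def K_def)
  have moved: "shift G s z \<noteq> z" if z: "z \<in> L" and s: "s \<in> carrier G" "s \<noteq> \<one>" for z s
  proof
    assume fixed: "shift G s z = z"
    obtain n where n: "\<gamma> n = s" using \<gamma>_surj s by blast
    have "z \<in> K n" using z by (simp add: L_def)
    then obtain \<delta> where \<delta>: "\<delta> \<in> D n" "z (\<delta> \<otimes> \<one>) \<noteq> z (\<delta> \<otimes> \<gamma> n \<otimes> \<one>)"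
      unfolding K_def using one_closed by blast
    have "\<delta> \<in> carrier G" using Dc \<delta> by blast
    then have "z \<delta> \<noteq> shift G s z \<delta>" using \<delta>(2) s n LZ[OF z] by (simp add: shift_apply)
    then show False using fixed by simp
  qed
  have free: "L \<subseteq> free_part G ?Z (shift G)"
    using moved LZ shift_one by (auto simp: free_part_def stabilizer_def)
  have top_free: "topspace (free_shift_space G) = free_part G ?Z (shift G)"
    by (auto simp: free_shift_space_def free_part_def)
  have f_cont: "continuous_map (subtopology ?Z (free_part G ?Z (shift G))) (discrete_topology {..<k}) f"
    using f by (simp add: continuous_coloring_def free_shift_space_def)
  have "closedin ?Z L" unfolding L_def using K_closed by (intro closedin_INT) auto
  then obtain f' where f': "locally_const ?Z f'" "\<forall>z\<in>L. f' z = f z"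
    using locally_const_extension[OF compact_space_cantor_power has_clopen_base_cantor_power _ free f_cont]
    by blast
  define T where "T = (S \<union> (\<lambda>\<sigma>. inv \<sigma>) ` S) - {\<one>}"
  have T: "finite T" "T \<subseteq> carrier G" "\<one> \<notin> T" using S by (auto simp: T_def)
  define good where "good = (\<lambda>z. f' z < k \<and> (\<forall>s\<in>T. f' z \<noteq> f' (shift G s z)))"
  have lc_good: "locally_const ?Z good"
    unfolding good_def
  proof (intro locally_const_conj locally_const_Ball T(1))
    show "locally_const ?Z (\<lambda>z. f' z < k)" by (rule locally_const_compose[OF f'(1)])
    show "locally_const ?Z (\<lambda>z. f' z \<noteq> f' (shift G s z))" if "s \<in> T" for s
      by (rule locally_const_compose2[OF f'(1) locally_const_pullback[OF f'(1) continuous_map_shift]])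
        (use that T in auto)
  qed
  have L_good: "good z" if z: "z \<in> L" for z
    unfolding good_def
  proof (intro conjI ballI)
    have zF: "z \<in> topspace (free_shift_space G)" using z free top_free by blast
    have "f z \<in> {..<k}" using f_cont zF unfolding continuous_map_def
      by (auto simp: free_shift_space_def Pi_iff)
    then show "f' z < k" using f'(2) z by simp
    fix s assume s: "s \<in> T"
    have sc: "s \<in> carrier G" "s \<noteq> \<one>" using s T by auto
    have sz: "shift G s z \<in> L" using z K_shift[OF _ sc(1)] by (auto simp: L_def)
    have "shift G s z \<in> topspace (free_shift_space G)" using sz free top_free by blast
    moreover have "s \<in> S \<union> (\<lambda>\<sigma>. inv \<sigma>) ` S" using s by (simp add: T_def)
    moreover have "shift G s z = free_shift G s z" using zF by (simp add: free_shift_def)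
    ultimately have "{z, shift G s z} \<in> schreier_edges G (free_shift_space G) (free_shift G) S"
      unfolding schreier_edges_def using zF moved[OF z sc, symmetric] by blast
    then have "f z \<noteq> f (shift G s z)" using f unfolding continuous_coloring_def by blast
    then show "f' z \<noteq> f' (shift G s z)" using f'(2) z sz by simp
  qed
  \<comment> \<open>The extension fails only on a closed set that misses the intersection of the \<open>K n\<close>.\<close>
  have "\<exists>n. K n \<inter> {z \<in> topspace ?Z. \<not> good z} = {}"
  proof (rule ccontr)
    assume ne: "\<not> ?thesis"
    have "(\<Inter>n. K n \<inter> {z \<in> topspace ?Z. \<not> good z}) \<noteq> {}"
    proof (rule compact_space_imp_nest[OF compact_space_cantor_power])
      show "closedin ?Z (K n \<inter> {z \<in> topspace ?Z. \<not> good z})" for n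
        by (intro closedin_Int K_closed locally_const_closedin locally_const_compose[OF lc_good])
      show "K n \<inter> {z \<in> topspace ?Z. \<not> good z} \<noteq> {}" for n using ne by blast
      show "decseq (\<lambda>n. K n \<inter> {z \<in> topspace ?Z. \<not> good z})"
        unfolding decseq_def using K_dec by blast
    qed
    then show False using L_good by (auto simp: L_def)
  qed
  then obtain n where n: "\<And>z. z \<in> K n \<Longrightarrow> good z" by (auto simp: K_def)
  define \<pi> where "\<pi> = (\<lambda>x. \<lambda>a\<in>carrier G. if c n (\<phi> a x) then 1 else (0::nat))"
  have \<pi>Z: "\<pi> x \<in> topspace ?Z" for x by (auto simp: \<pi>_def topspace_cantor_power)
  have \<pi>_cont: "continuous_map X ?Z \<pi>"
  proof (rule continuous_map_into_cantor_power)
    show "\<pi> x \<in> topspace ?Z" for x by (rule \<pi>Z)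
    show "locally_const X (\<lambda>x. \<pi> x a)" if "a \<in> carrier G" for a
      using locally_const_compose[OF locally_const_act[OF c[rule_format, of n] that],
          of "\<lambda>b. if b then 1 else (0::nat)"] that
      by (simp add: \<pi>_def)
  qed
  have \<pi>K: "\<pi> x \<in> K n" if x: "x \<in> topspace X" for x
    unfolding K_def
  proof (intro CollectI conjI \<pi>Z allI impI ballI)
    fix i a assume i: "i \<le> n" and a: "a \<in> carrier G"
    then obtain \<delta> where \<delta>: "\<delta> \<in> D i" "c n (\<phi> \<delta> (\<phi> a x)) \<noteq> c n (\<phi> (\<delta> \<otimes> \<gamma> i) (\<phi> a x))"
      using sep x by (meson act_in)
    have "\<delta> \<in> carrier G" using Dc \<delta> by blast
    then have "\<pi> x (\<delta> \<otimes> a) \<noteq> \<pi> x (\<delta> \<otimes> \<gamma> i \<otimes> a)"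
      using \<delta>(2) a \<gamma> x by (auto simp: \<pi>_def act_mult)
    then show "\<exists>\<delta>\<in>D i. \<pi> x (\<delta> \<otimes> a) \<noteq> \<pi> x (\<delta> \<otimes> \<gamma> i \<otimes> a)" using \<delta>(1) by blast
  qed
  have \<pi>_equiv: "\<pi> (\<phi> s x) = shift G s (\<pi> x)" if "x \<in> topspace X" "s \<in> carrier G" for x s
  proof
    fix a show "\<pi> (\<phi> s x) a = shift G s (\<pi> x) a"
      using that \<pi>Z[of x] by (simp add: shift_def \<pi>_def act_mult restrict_def)
  qed
  have \<pi>_good: "good (\<pi> x)" if "x \<in> topspace X" for x using n \<pi>K that by blast
  define h where "h = (\<lambda>x. f' (\<pi> x))"
  have "continuous_map X (discrete_topology {..<k}) h"
    unfolding h_def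
    by (rule locally_const_imp_continuous_map[OF locally_const_pullback[OF f'(1) \<pi>_cont]])
      (use \<pi>_good in \<open>auto simp: good_def\<close>)
  moreover have "h x \<noteq> h y" if xy: "{x, y} \<in> schreier_edges G X \<phi> S" for x y
  proof -
    obtain u v s where uv: "{x, y} = {u, v}" "u \<in> topspace X" "u \<noteq> v"
      "s \<in> S \<union> (\<lambda>\<sigma>. inv \<sigma>) ` S" "v = \<phi> s u"
      using xy unfolding schreier_edges_def by blast
    have "s \<noteq> \<one>"
    proof
      assume "s = \<one>"
      then have "v = u" using uv(2,5) by simp
      then show False using uv(3) by simp
    qed
    then have s: "s \<in> T" "s \<in> carrier G" using uv(4) S by (auto simp: T_def)
    have "h u \<noteq> h v"
      using \<pi>_good[OF uv(2)] s \<pi>_equiv[OF uv(2) s(2)] uv(5) by (simp add: h_def good_def)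
    then show ?thesis using uv(1) by (auto simp: doubleton_eq_iff)
  qed
  ultimately show ?thesis unfolding continuous_coloring_def by blast
qed

end

lemma separable_metrizable_imp_second_countable:
  assumes "separable_space X" "metrizable_space X"
  shows "second_countable X"
proof -
  obtain M d where "Metric_space M d" and X: "X = Metric_space.mtopology M d"
    using assms(2) unfolding metrizable_space_def by blast
  interpret Metric_space M d by fact
  obtain C where C: "countable C" "C \<subseteq> M" "mtopology closure_of C = M"
    using assms(1) unfolding separable_space_def X by auto
  have "\<exists>V\<in>(\<lambda>(c, n). mball c (inverse (real (Suc n)))) ` (C \<times> UNIV). x \<in> V \<and> V \<subseteq> U"
    if U: "openin mtopology U" "x \<in> U" for U x
  proof -
    obtain r where r: "r > 0" "mball x r \<subseteq> U" "x \<in> M"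
      using U unfolding openin_mtopology by blast
    obtain n where n: "inverse (real (Suc n)) < r / 2"
      using reals_Archimedean[of "r / 2"] r(1) by auto
    have "x \<in> mtopology closure_of C" using r C by simp
    then have "\<forall>r>0. \<exists>c\<in>C. c \<in> mball x r" unfolding metric_closure_of by blast
    moreover have "0 < inverse (real (Suc n))" by simp
    ultimately obtain c where c: "c \<in> C" "c \<in> mball x (inverse (real (Suc n)))" by blast
    have "x \<in> mball c (inverse (real (Suc n)))" using c(2) by (simp add: commute)
    moreover have "mball c (inverse (real (Suc n))) \<subseteq> mball x r"
      using c(2) n by (intro mball_subset) (auto simp: commute)
    ultimately show ?thesis using c(1) r(2) by blast
  qed
  then show ?thesis
    unfolding second_countable_def X using C(1)
    by (intro exI[of _ "(\<lambda>(c, n). mball c (inverse (real (Suc n)))) ` (C \<times> UNIV)"]) auto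
qed

lemma free_zero_dim_action_intro:
  assumes "group G" "infinite (carrier G)" "zero_dim_polish X" "free_gamma_space G X \<phi>"
  shows "free_zero_dim_action G X \<phi>"
proof -
  interpret group_action G "topspace X" \<phi>
    using assms(4) by (simp add: free_gamma_space_def gamma_space_def)
  have metr: "metrizable_space X"
    using assms(3) completely_metrizable_imp_metrizable_space
    by (auto simp: zero_dim_polish_def polish_top_def)
  have cont: "continuous_map (prod_topology (discrete_topology (carrier G)) X) X (\<lambda>(g, x). \<phi> g x)"
    using assms(4) by (simp add: free_gamma_space_def gamma_space_def)
  show ?thesis
  proof (intro free_zero_dim_action.intro free_zero_dim_action_axioms.intro)
    show "group G" by fact
    show "infinite (carrier G)" by fact
    show "\<phi> g x \<in> topspace X" if "g \<in> carrier G" "x \<in> topspace X" for g x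
      using element_image that by blast
    show "\<phi> \<one>\<^bsub>G\<^esub> x = x" if "x \<in> topspace X" for x
      using id_eq_one that by (metis restrict_apply')
    show "\<phi> (g \<otimes>\<^bsub>G\<^esub> h) x = \<phi> g (\<phi> h x)"
      if "g \<in> carrier G" "h \<in> carrier G" "x \<in> topspace X" for g h x
      using composition_rule that by blast
    show "g = \<one>\<^bsub>G\<^esub>" if "g \<in> carrier G" "x \<in> topspace X" "\<phi> g x = x" for g x
      using assms(4) that by (auto simp: free_gamma_space_def stabilizer_def)
    show "continuous_map X X (\<phi> g)" if "g \<in> carrier G" for g
    proof -
      have "continuous_map X (prod_topology (discrete_topology (carrier G)) X) (\<lambda>x. (g, x))"
        using that by (simp add: continuous_map_pairwise o_def)
      from continuous_map_compose[OF this cont] show ?thesis by (simp add: o_def)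
    qed
    show "Hausdorff_space X" using metr metrizable_imp_Hausdorff_space by blast
    show "Lindelof_space X"
      using assms(3) metr separable_metrizable_imp_second_countable second_countable_imp_Lindelof_space
      by (auto simp: zero_dim_polish_def polish_top_def)
    show "has_clopen_base X" using assms(3) by (simp add: zero_dim_polish_def)
  qed
qed

theorem corollary1p13:
  fixes \<Gamma> :: "('g, 'm) monoid_scheme"
    and S :: "'g set"
    and X :: "'x topology"
    and \<phi> :: "'g \<Rightarrow> 'x \<Rightarrow> 'x"
  assumes "group \<Gamma>" and "countable (carrier \<Gamma>)" and "infinite (carrier \<Gamma>)"
    and "finite S" and "S \<subseteq> carrier \<Gamma>"
    and "zero_dim_polish X" and "free_gamma_space \<Gamma> X \<phi>"
  shows "continuous_chromatic_number X (schreier_edges \<Gamma> X \<phi> S)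
    \<le> continuous_chromatic_number (free_shift_space \<Gamma>)
         (schreier_edges \<Gamma> (free_shift_space \<Gamma>) (free_shift \<Gamma>) S)"
proof -
  interpret free_zero_dim_action \<Gamma> X \<phi>
    using assms by (intro free_zero_dim_action_intro)
  show ?thesis
    unfolding continuous_chromatic_number_def
    using coloring_transfer[OF assms(4,5,2)] by (intro Inf_superset_mono) blast
qed

end
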